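(* Let $(\alpha_1,\alpha_2,\alpha_3)$ be an ordered triple of ordinary lattice angles. There exists a lattice triangle whose three consecutive ordinary lattice angles are lattice-congruent to $\alpha_1$, $\alpha_2$, $\alpha_3$ respectively if and only if there exists $i\in\{1,2,3\}$ such that the angles $\alpha=\alpha_i$, $\beta=\alpha_{i+1 \bmod 3}$, $\gamma=\alpha_{i+2 \bmod 3}$ (indices taken in $\{1,2,3\}$) satisfy both of the following conditions: (i) the element $]\operatorname{ltan}\alpha,-1,\operatorname{ltan}\beta[$ is either negative or greater than $\operatorname{ltan}\alpha$; (ii) $]\operatorname{ltan}\alpha,-1,\operatorname{ltan}\beta,-1,\operatorname{ltan}\gamma[\,=0$.
   Context: We work in $\mathbb R^2$ with its standard orientation and the lattice $\mathbb Z^2$; lattice points are points of $\mathbb Z^2$. A lattice-affine transformation is a map $x\mapsto Mx+b$ with $M\in GL_2(\mathbb Z)$, $b\in\mathbb Z^2$. An ordinary lattice angle $\angle AOB$ (with $A,O,B$ lattice points not on one line) is the ordered pair (ray $OA$, ray $OB$) with common vertex $O$; it depends only on $O$ and the two rays. Two ordinary lattice angles $\angle AOB,\angle A'O'B'$ are lattice-congruent if a lattice-affine transformation maps $O$ to $O'$, ray $OA$ onto ray $O'A'$ and ray $OB$ onto ray $O'B'$. A lattice triangle $ABC$ (lattice vertices, not collinear) has consecutive ordinary lattice angles $\angle CAB$, $\angle ABC$, $\angle BCA$. Lattice tangent: for $\angle AOB$ let $v_1,v_2$ be the primitive lattice vectors along rays $OA$, $OB$. The lattice points $P$ with $(v_1,P-O)$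 a basis of $\mathbb Z^2$ form two lines parallel to $OA$; ray $OB$ meets exactly one of them, $l$, at a point $Q$. Let $D$ be the lattice point of $l$ nearest to $Q$ among lattice points of $l$ lying strictly on the other side of line $OB$ from $A$. Then $(v_1,D-O)$ is a lattice basis and $v_2=x_1v_1+x_2(D-O)$ with integers $x_1,x_2$; the lattice sine is $\operatorname{lsin}\angle AOB=x_2$, lattice cosine $\operatorname{lcos}\angle AOB=x_1$, and lattice tangent $\operatorname{ltan}\angle AOB=x_2/x_1$ (a rational $\ge1$). Continued fractions: $\bar{\mathbb Q}=\mathbb Q\cup\{\infty\}$ with $q\pm\infty=\infty$, $1/0=\infty$, $1/\infty=0$. For integers $a_0,\dots,a_n$, $]a_0,a_1,\dots,a_n[\;=a_0+1/(a_1+1/(\cdots+1/a_n))\in\bar{\mathbb Q}$. For rationals $q_1,\dots,q_k$, write the odd continued fraction of each $q_j$, i.e. the unique expansion $q_j=[a_{j,0};a_{j,1},\dots,a_{j,2n_j}]$ with an odd number of terms ($a_{j,0}\in\mathbb Z$, the others positive integers; e.g. $-1=[-1]$), and set $]q_1,\dots,q_k[\;=\;]a_{1,0},\dots,a_{1,2n_1},a_{2,0},\dots,a_{2,2n_2},\dots,a_{k,0},\dots,a_{k,2n_k}[$. *)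

theory Defs
  imports "HOL-Analysis.Analysis"
begin

definition Z2 :: "(real^2) set" where
  "Z2 = {x. \<forall>i. x $ i \<in> \<int>}"

(* The matrix is taken over int, so invertibility is invertibility in GL_2(Z). *)
definition lattice_affine :: "(real^2 \<Rightarrow> real^2) \<Rightarrow> bool" where
  "lattice_affine f \<longleftrightarrow>
     (\<exists>M :: int^2^2. \<exists>b \<in> Z2. invertible M \<and> f = (\<lambda>x. map_matrix real_of_int M *v x + b))"

definition ray :: "real^2 \<Rightarrow> real^2 \<Rightarrow> (real^2) set" where
  "ray P A = {P + t *\<^sub>R (A - P) | t. 0 \<le> t}"

datatype angle =
  Angle (vertex: "real^2") (ray1: "(real^2) set") (ray2: "(real^2) set")

(* angle_at A P B is the angle APB with vertex P. *)
definition angle_at :: "real^2 \<Rightarrow> real^2 \<Rightarrow> real^2 \<Rightarrow> angle" where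
  "angle_at A P B = Angle P (ray P A) (ray P B)"

definition ordinary_lattice_angle :: "angle \<Rightarrow> bool" where
  "ordinary_lattice_angle \<alpha> \<longleftrightarrow>
     (\<exists>A\<in>Z2. \<exists>P\<in>Z2. \<exists>B\<in>Z2. \<not> collinear {A, P, B} \<and> \<alpha> = angle_at A P B)"

definition lattice_congruent :: "angle \<Rightarrow> angle \<Rightarrow> bool" where
  "lattice_congruent \<alpha> \<beta> \<longleftrightarrow>
     (\<exists>f. lattice_affine f \<and> f (vertex \<alpha>) = vertex \<beta> \<and>
          f ` ray1 \<alpha> = ray1 \<beta> \<and> f ` ray2 \<alpha> = ray2 \<beta>)"

definition lattice_triangle :: "real^2 \<Rightarrow> real^2 \<Rightarrow> real^2 \<Rightarrow> bool" where
  "lattice_triangle A B C \<longleftrightarrow> A \<in> Z2 \<and> B \<in> Z2 \<and> C \<in> Z2 \<and> \<not> collinear {A, B, C}"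

definition primitive_vector :: "real^2 \<Rightarrow> bool" where
  "primitive_vector v \<longleftrightarrow> v \<in> Z2 \<and> v \<noteq> 0 \<and> open_segment 0 v \<inter> Z2 = {}"

definition lattice_basis :: "real^2 \<Rightarrow> real^2 \<Rightarrow> bool" where
  "lattice_basis u v \<longleftrightarrow> u \<in> Z2 \<and> v \<in> Z2 \<and>
     (\<forall>w\<in>Z2. \<exists>!p :: int \<times> int. w = of_int (fst p) *\<^sub>R u + of_int (snd p) *\<^sub>R v)"

definition strictly_opposite :: "(real^2) set \<Rightarrow> real^2 \<Rightarrow> real^2 \<Rightarrow> bool" where
  "strictly_opposite L x y \<longleftrightarrow> x \<notin> L \<and> y \<notin> L \<and> closed_segment x y \<inter> L \<noteq> {}"

(* The definite descriptions below are all uniquely satisfied for ordinary lattice angles. *)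

definition prim1 :: "angle \<Rightarrow> real^2" where
  "prim1 \<alpha> = (THE v. primitive_vector v \<and> vertex \<alpha> + v \<in> ray1 \<alpha>)"

definition prim2 :: "angle \<Rightarrow> real^2" where
  "prim2 \<alpha> = (THE v. primitive_vector v \<and> vertex \<alpha> + v \<in> ray2 \<alpha>)"

(* The line l: of the two lines formed by the lattice points that complete prim1 to a basis,
   the one that meets the second ray. *)
definition tangent_line :: "angle \<Rightarrow> (real^2) set" where
  "tangent_line \<alpha> =
     (THE l. (\<exists>P. lattice_basis (prim1 \<alpha>) (P - vertex \<alpha>) \<and> P \<in> Z2 \<and>
                  l = {P + t *\<^sub>R prim1 \<alpha> | t. t \<in> UNIV}) \<and>
             l \<inter> ray2 \<alpha> \<noteq> {})"

definition tangent_meet :: "angle \<Rightarrow> real^2" where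
  "tangent_meet \<alpha> = (THE Q. Q \<in> tangent_line \<alpha> \<inter> ray2 \<alpha>)"

definition tangent_point :: "angle \<Rightarrow> real^2" where
  "tangent_point \<alpha> =
     (THE D. is_arg_min (\<lambda>P. dist (tangent_meet \<alpha>) P)
        (\<lambda>P. P \<in> Z2 \<inter> tangent_line \<alpha> \<and>
             strictly_opposite (affine hull {vertex \<alpha>, vertex \<alpha> + prim2 \<alpha>})
               (vertex \<alpha> + prim1 \<alpha>) P) D)"

definition lcos_lsin :: "angle \<Rightarrow> int \<times> int" where
  "lcos_lsin \<alpha> =
     (THE p. prim2 \<alpha> = of_int (fst p) *\<^sub>R prim1 \<alpha> +
                        of_int (snd p) *\<^sub>R (tangent_point \<alpha> - vertex \<alpha>))"

definition lcos :: "angle \<Rightarrow> int" where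
  "lcos \<alpha> = fst (lcos_lsin \<alpha>)"

definition lsin :: "angle \<Rightarrow> int" where
  "lsin \<alpha> = snd (lcos_lsin \<alpha>)"

definition ltan :: "angle \<Rightarrow> rat" where
  "ltan \<alpha> = of_int (lsin \<alpha>) / of_int (lcos \<alpha>)"

(* Values are in the rationals extended by one point infinity, embedded in ereal with infinity
   going to +infinity. There 1 / 0 = \<infinity>, 1 / \<infinity> = 0 and a + \<infinity> = \<infinity>, so -\<infinity> never arises.
   The empty fraction is \<infinity>, which makes cf [a] = a. *)
fun cf :: "int list \<Rightarrow> ereal" where
  "cf [] = \<infinity>"
| "cf (a # as) = ereal (of_int a) + 1 / cf as"

definition odd_cf :: "rat \<Rightarrow> int list" where
  "odd_cf q = (THE as. odd (length as) \<and> (\<forall>a \<in> set (tl as). 0 < a) \<and>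
                       cf as = ereal (of_rat q))"

definition cf_rats :: "rat list \<Rightarrow> ereal" where
  "cf_rats qs = cf (concat (map odd_cf qs))"

end

theory Submission
  imports Defs
begin

text \<open>
  An angle with lattice tangent \<open>p / q\<close> is determined up to congruence by \<open>(p, q)\<close>. The odd continued
  fraction of \<open>p / q\<close> has matrix \<open>((p, r), (q, s))\<close> of determinant \<open>-1\<close>, so \<open>r\<close> is the inverse of \<open>q\<close>
  modulo \<open>p\<close>. Fixing a side of a triangle as a coordinate axis, its two adjacent angles
  determine the third up to a shear along this side, which gives \<open>p3 = p1 q2 + p2 r1 - n p1 p2\<close> for
  an integer \<open>n \<le> 1\<close>. Multiplying continued fraction matrices, conditions (i) and (ii) together say exactly
  that \<open>n = 1\<close> at the side between \<open>\<alpha>\<close> and \<open>\<beta>\<close> and at the side between \<open>\<beta>\<close> and \<open>\<gamma>\<close>. Two of the three sides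
  always satisfy \<open>n = 1\<close>, since \<open>n \<le> 0\<close> makes the lattice sine of the opposite angle the strictly
  largest one. Conversely, these two equations suffice to write down the triangle.
\<close>

section \<open>Continued fractions as projective maps\<close>

text \<open>The action on column vectors of the product of the matrices
  \<open>((a, 1), (1, 0))\<close> over the list. Concatenation becomes matrix multiplication, and
  integer pairs avoid division by zero.\<close>

fun cf_act :: "int list \<Rightarrow> int \<times> int \<Rightarrow> int \<times> int" where
  "cf_act [] z = z"
| "cf_act (a # as) z = (a * fst (cf_act as z) + snd (cf_act as z), fst (cf_act as z))"

text \<open>Homogeneous coordinates on the projective line. Its one infinite point is
  \<open>\<infinity>\<close>, in agreement with \<open>cf\<close>, whatever the sign of the
  numerator.\<close>

definition proj_point :: "int \<times> int \<Rightarrow> ereal" where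
  "proj_point z = (if snd z = 0 then \<infinity> else ereal (of_int (fst z) / of_int (snd z)))"

lemma proj_point_eq_0_iff: "proj_point z = 0 \<longleftrightarrow> snd z \<noteq> 0 \<and> fst z = 0"
  by (auto simp: proj_point_def)

lemma cf_act_append: "cf_act (as @ bs) z = cf_act as (cf_act bs z)"
  by (induction as) auto

text \<open>Each partial quotient contributes a factor of determinant -1, so the determinant of the
  product records the parity of the length.\<close>

lemma cf_act_linear:
  "\<exists>p r q s. (\<forall>x y. cf_act as (x, y) = (p * x + r * y, q * x + s * y)) \<and>
             p * s - q * r = (- 1) ^ length as"
proof (induction as)
  case Nil
  show ?case
    by (rule exI[of _ 1], rule exI[of _ 0], rule exI[of _ 0], rule exI[of _ 1]) simp
next
  case (Cons a as)
  then obtain p r q s where m: "\<And>x y. cf_act as (x, y) = (p * x + r * y, q * x + s * y)"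
    and d: "p * s - q * r = (- 1) ^ length as"
    by blast
  show ?case
  proof (rule exI[of _ "a * p + q"], rule exI[of _ "a * r + s"], rule exI[of _ p],
      rule exI[of _ r], intro conjI allI)
    show "cf_act (a # as) (x, y) = ((a * p + q) * x + (a * r + s) * y, p * x + r * y)" for x y
      by (simp add: m algebra_simps)
    have "(a * p + q) * r - p * (a * r + s) = - (p * s - q * r)"
      by (simp add: algebra_simps)
    then show "(a * p + q) * r - p * (a * r + s) = (- 1) ^ length (a # as)"
      using d by simp
  qed
qed

lemma coprime_of_det:
  fixes p q r s :: int
  assumes "\<bar>p * s - q * r\<bar> = 1"
  shows "coprime p q"
proof (rule coprimeI)
  fix c assume "c dvd p" "c dvd q"
  then have "c dvd p * s - q * r" by (simp add: dvd_diff)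
  then show "is_unit c" using assms by (metis dvd_abs_iff)
qed

lemma cf_act_coprime: "coprime (fst (cf_act as (1, 0))) (snd (cf_act as (1, 0)))"
proof -
  obtain p r q s where m: "\<And>x y. cf_act as (x, y) = (p * x + r * y, q * x + s * y)"
    and d: "p * s - q * r = (- 1) ^ length as"
    using cf_act_linear by blast
  have "\<bar>p * s - q * r\<bar> = 1" by (simp add: d power_abs)
  then show ?thesis using m[of 1 0] coprime_of_det by simp
qed

text \<open>Coprimality excludes the pair \<open>(0, 0)\<close>, so the recursion of
  \<open>cf\<close> and its homogeneous form agree even where a tail has value 0 or
  infinity.\<close>

lemma cf_eq_proj_point: "cf as = proj_point (cf_act as (1, 0))"
proof (induction as)
  case Nil
  then show ?case by (simp add: proj_point_def)
next
  case (Cons a as)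
  define x y where "x = fst (cf_act as (1, 0))" and "y = snd (cf_act as (1, 0))"
  have c: "coprime x y" unfolding x_def y_def by (rule cf_act_coprime)
  have v: "cf as = (if y = 0 then \<infinity> else ereal (of_int x / of_int y))"
    using Cons by (simp add: proj_point_def x_def y_def)
  have w: "cf_act (a # as) (1, 0) = (a * x + y, x)"
    by (simp add: x_def y_def)
  consider "x = 0" "y \<noteq> 0" | "x \<noteq> 0" "y = 0" | "x \<noteq> 0" "y \<noteq> 0"
    using c by fastforce
  then show ?case
  proof cases
    case 1
    then show ?thesis by (simp only: w) (simp add: v proj_point_def)
  next
    case 2
    then show ?thesis by (simp only: w) (simp add: v proj_point_def)
  next
    case 3
    then show ?thesis
      by (simp only: w) (simp add: v proj_point_def one_ereal_def field_simps)
  qed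
qed

section \<open>Uniqueness and existence of expansions of given parity\<close>

lemma cf_act_pos:
  assumes "\<forall>a\<in>set as. 0 < a"
  shows "0 < fst (cf_act as (1, 0))" "0 \<le> snd (cf_act as (1, 0))"
  using assms by (induction as) (auto simp: add_pos_nonneg)

text \<open>This isolates the only ambiguity of continued fractions: the reciprocal of a positive
  tail lies between 0 and 1, and its endpoint 1, reached by \<open>[1]\<close> alone, is what makes
  \<open>[a, 1]\<close> and \<open>[a + 1]\<close> equal.\<close>

lemma cf_act_snd_le:
  assumes "\<forall>a\<in>set as. 0 < a"
  shows "snd (cf_act as (1, 0)) \<le> fst (cf_act as (1, 0))"
    and "snd (cf_act as (1, 0)) = fst (cf_act as (1, 0)) \<Longrightarrow> as = [1]"
    and "snd (cf_act as (1, 0)) = 0 \<Longrightarrow> as = []"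
proof -
  have "snd (cf_act as (1, 0)) \<le> fst (cf_act as (1, 0)) \<and>
    (snd (cf_act as (1, 0)) = fst (cf_act as (1, 0)) \<longrightarrow> as = [1]) \<and>
    (snd (cf_act as (1, 0)) = 0 \<longrightarrow> as = [])"
  proof (cases as)
    case Nil
    then show ?thesis by simp
  next
    case (Cons a bs)
    define x y where "x = fst (cf_act bs (1, 0))" and "y = snd (cf_act bs (1, 0))"
    have xy: "0 < x" "0 \<le> y" using cf_act_pos[of bs] assms Cons by (auto simp: x_def y_def)
    have a: "1 \<le> a" using assms Cons by auto
    have ax: "x \<le> a * x" using mult_right_mono[OF a, of x] xy by simp
    have "as = [1]" if e: "x = a * x + y"
    proof -
      have y0: "y = 0" and "a * x = x" using e ax xy by linarith+
      then have a1: "a = 1" using xy by simp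
      have "bs = []"
      proof (cases bs)
        case (Cons b cs)
        have "0 < y" using cf_act_pos(1)[of cs] assms \<open>as = a # bs\<close> Cons by (simp add: y_def)
        then show ?thesis using y0 by simp
      qed simp
      then show ?thesis using a1 Cons by simp
    qed
    moreover have "x \<le> a * x + y" using ax xy by linarith
    ultimately show ?thesis using xy Cons by (auto simp: x_def[symmetric] y_def[symmetric])
  qed
  then show "snd (cf_act as (1, 0)) \<le> fst (cf_act as (1, 0))"
    and "snd (cf_act as (1, 0)) = fst (cf_act as (1, 0)) \<Longrightarrow> as = [1]"
    and "snd (cf_act as (1, 0)) = 0 \<Longrightarrow> as = []" by auto
qed

text \<open>Comparing first entries gives \<open>(b - a) * x = y - z\<close> with \<open>y\<close>
  and \<open>z\<close> between 0 and \<open>x\<close>. Hence the heads agree, or they differ by one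
  and the tails are \<open>[1]\<close> and \<open>[]\<close>, which the common parity
  forbids.\<close>

lemma cf_act_inj:
  assumes "as \<noteq> []" "bs \<noteq> []" "\<forall>a\<in>set (tl as). 0 < a" "\<forall>b\<in>set (tl bs). 0 < b"
    and "even (length as) \<longleftrightarrow> even (length bs)" "cf_act as (1, 0) = cf_act bs (1, 0)"
  shows "as = bs"
  using assms
proof (induction as arbitrary: bs)
  case Nil
  then show ?case by simp
next
  case (Cons a as)
  obtain b bs' where bs: "bs = b # bs'" using Cons.prems(2) by (cases bs) auto
  define x y where "x = fst (cf_act as (1, 0))" and "y = snd (cf_act as (1, 0))"
  define z where "z = snd (cf_act bs' (1, 0))"
  have pos: "\<forall>a\<in>set as. 0 < a" "\<forall>b\<in>set bs'. 0 < b" using Cons.prems bs by auto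
  have x': "x = fst (cf_act bs' (1, 0))" and e: "a * x + y = b * x + z"
    using Cons.prems(6) by (auto simp: bs x_def y_def z_def)
  note A = cf_act_pos[OF pos(1)] cf_act_snd_le[OF pos(1)]
  note B = cf_act_pos[OF pos(2)] cf_act_snd_le[OF pos(2)]
  have parity: "even (length as) \<longleftrightarrow> even (length bs')" using Cons.prems(5) bs by simp
  have x: "0 < x" "0 \<le> y" "y \<le> x" "0 \<le> z" "z \<le> x"
    using A B by (auto simp: x_def y_def z_def x'[unfolded x_def])
  have e': "(b - a) * x = y - z" using e by (simp add: algebra_simps)
  consider "a = b" | "a < b" | "b < a" by linarith
  then show ?case
  proof cases
    case 1
    then have yz: "y = z" using e by simp
    have eq: "cf_act as (1, 0) = cf_act bs' (1, 0)"
      using x' yz by (simp add: x_def y_def z_def prod_eq_iff)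
    have "as = bs'"
    proof (cases "as = [] \<or> bs' = []")
      case True
      then have "y = 0" using yz by (auto simp: y_def z_def)
      then show ?thesis using A B yz by (auto simp: y_def z_def)
    next
      case False
      then show ?thesis
        using Cons.IH[of bs'] pos parity eq by (auto dest: list.set_sel(2))
    qed
    then show ?thesis using 1 bs by simp
  next
    case 2
    then have "x \<le> (b - a) * x" using mult_right_mono[of 1 "b - a" x] x by simp
    then have "y = x" "z = 0" using e' x by linarith+
    then have "as = [1]" "bs' = []" using A B by (auto simp: x_def y_def z_def)
    then show ?thesis using parity by simp
  next
    case 3
    then have "x \<le> (a - b) * x" using mult_right_mono[of 1 "a - b" x] x by simp
    then have "z = x" "y = 0" using e' x by (auto simp: algebra_simps)
    then have "bs' = [1]" "as = []" using A B x' by (auto simp: x_def y_def z_def)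
    then show ?thesis using parity by simp
  qed
qed

text \<open>The Euclidean algorithm. Both parities are carried through the induction because
  prepending a quotient exchanges them; the even one needs \<open>q < p\<close>, since
  \<open>[p - 1, 1]\<close> must have a positive head.\<close>

lemma cf_act_exists:
  fixes p q :: int
  assumes "1 \<le> q" "q \<le> p" "coprime p q"
  shows "(\<exists>as. odd (length as) \<and> (\<forall>a\<in>set as. 0 < a) \<and> cf_act as (1, 0) = (p, q)) \<and>
    (q < p \<longrightarrow> (\<exists>as. even (length as) \<and> (\<forall>a\<in>set as. 0 < a) \<and> cf_act as (1, 0) = (p, q)))"
  using assms
proof (induction "nat q" arbitrary: p q rule: less_induct)
  case less
  show ?case
  proof (cases "q = 1")
    case True
    then show ?thesis
      using less.prems exI[of "\<lambda>as. odd (length as) \<and> (\<forall>a\<in>set as. 0 < a) \<and> cf_act as (1, 0) = (p, q)" "[p]"]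
        exI[of "\<lambda>as. even (length as) \<and> (\<forall>a\<in>set as. 0 < a) \<and> cf_act as (1, 0) = (p, q)" "[p - 1, 1]"]
      by simp
  next
    case False
    define a r where "a = p div q" and "r = p mod q"
    have pa: "p = a * q + r" by (simp add: a_def r_def)
    have "r \<noteq> 0"
    proof
      assume "r = 0"
      then have "q dvd p" by (simp add: r_def mod_0_imp_dvd)
      then have "is_unit q" using less.prems(3) by (simp add: coprime_absorb_right)
      then show False using False less.prems by simp
    qed
    moreover have "0 \<le> r" "r < q" using less.prems by (simp_all add: r_def)
    ultimately have r: "1 \<le> r" "r < q" by linarith+
    have a: "0 < a" using less.prems by (simp add: a_def pos_imp_zdiv_pos_iff)
    have "coprime q r" using less.prems(3) less.prems(1)
      by (simp add: r_def coprime_commute[of q] coprime_mod_left_iff)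
    then obtain as bs where
      l: "odd (length as)" "\<forall>a\<in>set as. 0 < a" "cf_act as (1, 0) = (q, r)"
      "even (length bs)" "\<forall>a\<in>set bs. 0 < a" "cf_act bs (1, 0) = (q, r)"
      using less.hyps[of r q] r by auto
    have "cf_act (a # as) (1, 0) = (p, q)" "cf_act (a # bs) (1, 0) = (p, q)"
      using l pa by simp_all
    moreover have "even (length (a # as))" "odd (length (a # bs))"
      "\<forall>x\<in>set (a # as). 0 < x" "\<forall>x\<in>set (a # bs). 0 < x" using l a by simp_all
    ultimately show ?thesis by blast
  qed
qed

lemma cf_act_snd_pos:
  assumes "as \<noteq> []" "\<forall>a\<in>set (tl as). 0 < a"
  shows "0 < snd (cf_act as (1, 0))"
  using assms cf_act_pos(1)[of "tl as"] by (cases as) auto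

lemma coprime_fraction_unique:
  fixes p q p' q' :: int
  assumes "coprime p q" "coprime p' q'" "0 < q" "0 < q'" "p * q' = p' * q"
  shows "p = p' \<and> q = q'"
proof -
  have "q dvd p * q'" "q' dvd p' * q" using assms(5) by (metis dvd_triv_right)+
  then have "q dvd q'" "q' dvd q"
    using assms(1,2) by (simp_all add: coprime_dvd_mult_right_iff coprime_commute)
  then have "q = q'" using assms zdvd_antisym_nonneg by force
  then show ?thesis using assms by simp
qed

text \<open>Coprimality and positive denominators turn equality of values into equality of integer
  pairs, after which \<open>cf_act_inj\<close> gives the uniqueness required by the definite
  description.\<close>

lemma odd_cf_eqI:
  assumes "odd (length as)" "\<forall>a\<in>set (tl as). 0 < a" "cf_act as (1, 0) = (p, q)"
  shows "odd_cf (of_int p / of_int q) = as"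
  unfolding odd_cf_def
proof (rule the_equality)
  have ne: "as \<noteq> []" using assms(1) by auto
  have q: "0 < q" using cf_act_snd_pos[OF ne assms(2)] assms(3) by simp
  have cp: "coprime p q" using cf_act_coprime[of as] assms(3) by simp
  have v: "ereal (of_rat (of_int p / of_int q)) = proj_point (p, q)"
    using q by (simp add: proj_point_def of_rat_divide)
  show "odd (length as) \<and> (\<forall>a\<in>set (tl as). 0 < a) \<and>
      cf as = ereal (of_rat (of_int p / of_int q))"
    using assms v by (simp add: cf_eq_proj_point)
  fix bs
  assume b: "odd (length bs) \<and> (\<forall>a\<in>set (tl bs). 0 < a) \<and>
      cf bs = ereal (of_rat (of_int p / of_int q))"
  then have nb: "bs \<noteq> []" by auto
  obtain x y where xy: "cf_act bs (1, 0) = (x, y)" by fastforce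
  have y: "0 < y" using cf_act_snd_pos[OF nb] b xy by simp
  have "proj_point (x, y) = proj_point (p, q)" using b v xy by (simp add: cf_eq_proj_point)
  then have "real_of_int x / of_int y = of_int p / of_int q"
    using q y by (simp add: proj_point_def)
  then have "real_of_int (x * q) = real_of_int (p * y)" using q y by (simp add: field_simps)
  then have "x * q = p * y" by (simp only: of_int_eq_iff)
  then have "x = p \<and> y = q"
    using coprime_fraction_unique[of x y p q] cf_act_coprime[of bs] xy cp q y by simp
  then show "bs = as"
    using cf_act_inj[of bs as] b nb ne assms xy by simp
qed

section \<open>The matrix of an odd continued fraction\<close>

text \<open>The second column is dominated by the first. The bound on its top entry \<open>r\<close>
  selects one representative of the inverse of \<open>q\<close> modulo \<open>p\<close>, from 1 to
  \<open>p\<close>.\<close>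

lemma cf_act_pos_matrix:
  assumes "as \<noteq> []" "\<forall>a\<in>set as. 0 < a"
  shows "1 \<le> fst (cf_act as (0, 1)) \<and> fst (cf_act as (0, 1)) \<le> fst (cf_act as (1, 0)) \<and>
    0 \<le> snd (cf_act as (0, 1)) \<and> snd (cf_act as (0, 1)) \<le> snd (cf_act as (1, 0))"
  using assms
proof (induction as)
  case Nil
  then show ?case by simp
next
  case (Cons a as)
  show ?case
  proof (cases "as = []")
    case True
    then show ?thesis using Cons.prems by simp
  next
    case False
    define r p s q where defs: "r = fst (cf_act as (0, 1))" "p = fst (cf_act as (1, 0))"
      "s = snd (cf_act as (0, 1))" "q = snd (cf_act as (1, 0))"
    have IH: "1 \<le> r" "r \<le> p" "0 \<le> s" "s \<le> q" using Cons False by (auto simp: defs)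
    have a: "1 \<le> a" using Cons.prems by auto
    have "a * r \<le> a * p" "1 * r \<le> a * r"
      using a IH by (auto intro!: mult_left_mono mult_right_mono)
    then have "1 \<le> a * r + s" "a * r + s \<le> a * p + q" using IH by linarith+
    then show ?thesis using IH by (simp add: defs[symmetric])
  qed
qed

text \<open>The equation \<open>q * r = 1 + p * s\<close> says that the matrix
  \<open>((p, r), (q, s))\<close> has determinant -1, as an odd length demands.\<close>

definition odd_cf_matrix :: "int \<Rightarrow> int \<Rightarrow> int \<Rightarrow> int \<Rightarrow> bool" where
  "odd_cf_matrix p q r s \<longleftrightarrow> 1 \<le> q \<and> q \<le> p \<and> 1 \<le> r \<and> r \<le> p \<and> q * r = 1 + p * s \<and>
     (\<forall>x y. cf_act (odd_cf (of_int p / of_int q)) (x, y) = (p * x + r * y, q * x + s * y))"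

lemma odd_cf_matrix_exists:
  fixes p q :: int
  assumes "1 \<le> q" "q \<le> p" "coprime p q"
  obtains r s where "odd_cf_matrix p q r s"
proof -
  obtain as where as: "odd (length as)" "\<forall>a\<in>set as. 0 < a" "cf_act as (1, 0) = (p, q)"
    using cf_act_exists[OF assms] by blast
  have ne: "as \<noteq> []" using as(1) by auto
  have o: "odd_cf (of_int p / of_int q) = as"
    using as ne by (intro odd_cf_eqI) (auto dest: list.set_sel(2))
  obtain p' r q' s where m: "\<And>x y. cf_act as (x, y) = (p' * x + r * y, q' * x + s * y)"
    and d: "p' * s - q' * r = (- 1) ^ length as"
    using cf_act_linear by blast
  have "p' = p" "q' = q" using m[of 1 0] as(3) by auto
  moreover have "1 \<le> r" "r \<le> p" using cf_act_pos_matrix[OF ne as(2)] m[of 0 1] as(3) by auto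
  ultimately have "odd_cf_matrix p q r s"
    using m d o as(1) assms by (simp add: odd_cf_matrix_def)
  then show thesis by (rule that)
qed

lemma odd_cf_minus_one: "odd_cf (- 1) = [- 1]"
  using odd_cf_eqI[of "[- 1]" "- 1" 1] by simp

section \<open>Conditions (i) and (ii) as integer equations\<close>

text \<open>Condition (i) amounts to \<open>0 < N\<close> for the numerator \<open>N\<close> of the
  shorter fraction. Given this sign, coprimality splits the single equation (ii) into the two
  equations on the right.\<close>

lemma cf_rats_condition_iff:
  assumes "odd_cf_matrix p1 q1 r1 s1" "odd_cf_matrix p2 q2 r2 s2" "odd_cf_matrix p3 q3 r3 s3"
  defines "t1 \<equiv> of_int p1 / of_int q1" and "t2 \<equiv> of_int p2 / of_int q2"
    and "t3 \<equiv> of_int p3 / of_int q3"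
  shows "(cf_rats [t1, - 1, t2] < 0 \<or> cf_rats [t1, - 1, t2] > ereal (of_rat t1)) \<and>
      cf_rats [t1, - 1, t2, - 1, t3] = 0 \<longleftrightarrow>
    p3 = p1 * q2 + p2 * r1 - p1 * p2 \<and> p1 = p2 * q3 + p3 * r2 - p2 * p3"
proof -
  \<comment> \<open>\<open>((N, N'), (D, D'))\<close> is the product of the matrices of
    \<open>t1\<close>, -1 and \<open>t2\<close>.\<close>
  define N N' D D' where N_def: "N = p1 * q2 + p2 * r1 - p1 * p2"
    and N'_def: "N' = (r1 - p1) * r2 + p1 * s2"
    and D_def: "D = q1 * (q2 - p2) + s1 * p2" and D'_def: "D' = (s1 - q1) * r2 + q1 * s2"
  have pos: "0 < p1" "0 < q1" "0 < p2" "0 < q2" "0 < p3" "0 < q3"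
    and det: "q1 * r1 = 1 + p1 * s1" "q2 * r2 = 1 + p2 * s2" "q3 * r3 = 1 + p3 * s3"
    and m: "\<And>x y. cf_act (odd_cf t1) (x, y) = (p1 * x + r1 * y, q1 * x + s1 * y)"
      "\<And>x y. cf_act (odd_cf t2) (x, y) = (p2 * x + r2 * y, q2 * x + s2 * y)"
      "\<And>x y. cf_act (odd_cf t3) (x, y) = (p3 * x + r3 * y, q3 * x + s3 * y)"
    using assms by (auto simp: odd_cf_matrix_def)
  have X: "cf_rats [t1, - 1, t2] = proj_point (N, D)"
    by (simp add: cf_rats_def cf_eq_proj_point cf_act_append odd_cf_minus_one m N_def D_def
        algebra_simps)
  have Y: "cf_rats [t1, - 1, t2, - 1, t3] =
      proj_point (N * (q3 - p3) + N' * p3, D * (q3 - p3) + D' * p3)"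
    by (simp add: cf_rats_def cf_eq_proj_point cf_act_append odd_cf_minus_one m N_def D_def
        N'_def D'_def algebra_simps)
  \<comment> \<open>This cross product compares \<open>N / D\<close> with \<open>t1\<close>; its
    sign is fixed because \<open>p2\<close> is positive.\<close>
  have ND: "N * q1 - D * p1 = p2"
  proof -
    have "N * q1 - D * p1 = p2 * (q1 * r1 - p1 * s1)" by (simp add: N_def D_def algebra_simps)
    then show ?thesis by (simp add: det)
  qed
  have det': "N * D' - N' * D = - 1"
  proof -
    have "N * D' - N' * D = - ((q1 * r1 - p1 * s1) * (q2 * r2 - p2 * s2))"
      by (simp add: N_def N'_def D_def D'_def algebra_simps)
    then show ?thesis by (simp add: det)
  qed
  have p2N': "p2 * N' = r2 * N - p1"
  proof -
    have "p2 * N' = r2 * N - p1 * (q2 * r2 - p2 * s2)"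
      by (simp add: N_def N'_def algebra_simps)
    then show ?thesis by (simp add: det)
  qed
  have t1: "of_rat t1 = real_of_int p1 / of_int q1" by (simp add: t1_def of_rat_divide)
  \<comment> \<open>If \<open>D\<close> is 0 or positive, then \<open>N\<close> is positive and the
    value is infinite or exceeds \<open>t1\<close>. If \<open>D\<close> is negative, the value lies
    below \<open>t1\<close>, so only being negative remains, which means
    \<open>0 < N\<close>.\<close>
  have i: "(proj_point (N, D) < 0 \<or> proj_point (N, D) > ereal (of_rat t1)) \<longleftrightarrow> 0 < N"
  proof -
    consider "D = 0" | "D > 0" | "D < 0" by linarith
    then show ?thesis
    proof cases
      case 1
      then have "0 < N * q1" using ND pos by simp
      then show ?thesis using 1 pos by (simp add: proj_point_def zero_less_mult_iff)
    next
      case 2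
      then have NDpos: "D * p1 < N * q1" using ND pos by simp
      have N: "0 < N"
        using less_trans[OF mult_pos_pos[OF 2 pos(1)] NDpos] pos by (simp add: zero_less_mult_iff)
      have "real_of_int (D * p1) < real_of_int (N * q1)" using NDpos by (simp only: of_int_less_iff)
      then have "real_of_int p1 / of_int q1 < of_int N / of_int D"
        using 2 pos by (simp add: field_simps)
      then show ?thesis using 2 N by (simp add: proj_point_def t1)
    next
      case 3
      have NDpos: "D * p1 < N * q1" using ND pos by simp
      then have "real_of_int (D * p1) < real_of_int (N * q1)" by (simp only: of_int_less_iff)
      then have "real_of_int N / of_int D < of_int p1 / of_int q1"
        using 3 pos by (simp add: field_simps)
      then show ?thesis
        using 3 by (auto simp: proj_point_def t1 divide_less_0_iff)
    qed
  qed
  have ii: "proj_point (N * (q3 - p3) + N' * p3, D * (q3 - p3) + D' * p3) = 0 \<longleftrightarrow>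
      N * (q3 - p3) + N' * p3 = 0"
  proof -
    \<comment> \<open>Numerator and denominator cannot both vanish, since the matrix is invertible
      and \<open>p3\<close> is nonzero.\<close>
    have "D * (q3 - p3) + D' * p3 \<noteq> 0" if "N * (q3 - p3) + N' * p3 = 0"
    proof
      assume d: "D * (q3 - p3) + D' * p3 = 0"
      have "p3 * (N * D' - N' * D) = 
          N * (D * (q3 - p3) + D' * p3) - D * (N * (q3 - p3) + N' * p3)"
        by (simp add: algebra_simps)
      then show False using d that det' pos by simp
    qed
    then show ?thesis unfolding proj_point_eq_0_iff fst_conv snd_conv by blast
  qed
  \<comment> \<open>The vanishing numerator makes \<open>N\<close> and \<open>p3\<close> divide each
    other, as \<open>N\<close>, \<open>N'\<close> and \<open>p3\<close>, \<open>q3\<close> are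
    coprime pairs; positivity of \<open>N\<close> excludes \<open>N = - p3\<close>. Then
    \<open>N' = p3 - q3\<close>, which \<open>p2N'\<close> turns into the equation for
    \<open>p1\<close>.\<close>
  have "0 < N \<and> N * (q3 - p3) + N' * p3 = 0 \<longleftrightarrow> p3 = N \<and> p1 = p2 * q3 + p3 * r2 - p2 * p3"
  proof
    assume a: "0 < N \<and> N * (q3 - p3) + N' * p3 = 0"
    have cN: "coprime N N'"
      using coprime_of_det[of N D' N' D] det' by simp
    have c3: "coprime p3 q3"
      using coprime_of_det[of p3 s3 q3 r3] det by simp
    have "N * q3 = p3 * (N - N')" "N' * p3 = N * (p3 - q3)"
      using a by (simp_all add: algebra_simps)
    then have "p3 dvd N * q3" "N dvd N' * p3" by simp_all
    then have "p3 dvd N" "N dvd p3"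
      using cN c3 by (simp_all add: coprime_dvd_mult_left_iff coprime_dvd_mult_right_iff)
    then have "p3 = N" using a pos zdvd_antisym_nonneg by force
    moreover from this have "N' = p3 - q3" using a pos
      by (metis \<open>N' * p3 = N * (p3 - q3)\<close> less_irrefl mult.commute mult_cancel_left)
    ultimately have "p2 * (N - q3) = r2 * N - p1" "p3 = N" using p2N' by simp_all
    then show "p3 = N \<and> p1 = p2 * q3 + p3 * r2 - p2 * p3"
      by (simp add: algebra_simps)
  next
    assume a: "p3 = N \<and> p1 = p2 * q3 + p3 * r2 - p2 * p3"
    then have "p2 * N' = p2 * (p3 - q3)" using p2N' by (auto simp: algebra_simps)
    then have N': "N' = p3 - q3" using pos by simp
    have "N = p3" using a by simp
    then show "0 < N \<and> N * (q3 - p3) + N' * p3 = 0"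
      unfolding N' using pos by (simp add: algebra_simps)
  qed
  then show ?thesis by (simp only: X Y i ii flip: N_def)
qed

lemma two_sides_minimal:
  fixes p1 p2 p3 q1 q2 q3 r1 r2 r3 n1 n2 n3 :: int
  assumes pos: "1 \<le> q1" "q1 \<le> p1" "1 \<le> q2" "q2 \<le> p2" "1 \<le> q3" "q3 \<le> p3"
      "1 \<le> r1" "r1 \<le> p1" "1 \<le> r2" "r2 \<le> p2" "1 \<le> r3" "r3 \<le> p3"
    and n3: "p3 = p1 * q2 + p2 * r1 - n3 * (p1 * p2)"
    and n1: "p1 = p2 * q3 + p3 * r2 - n1 * (p2 * p3)"
    and n2: "p2 = p3 * q1 + p1 * r3 - n2 * (p3 * p1)"
  shows "n3 = 1 \<and> n1 = 1 \<or> n1 = 1 \<and> n2 = 1 \<or> n2 = 1 \<and> n3 = 1"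
proof -
  \<comment> \<open>A side with \<open>n \<le> 0\<close> forces the opposite \<open>p\<close> above the other two, so there is at most one.\<close>
  have le: "n \<le> 1" and big: "n \<le> 0 \<Longrightarrow> x + y \<le> z"
    if "z = x * q + y * r - n * (x * y)" "1 \<le> q" "q \<le> y" "1 \<le> r" "r \<le> x" "1 \<le> z"
    for x y z q r n :: int
  proof -
    have xy: "1 \<le> x" "1 \<le> y" using that by linarith+
    have "x * q \<le> x * y" using that xy by (auto intro!: mult_left_mono)
    moreover have "y * r \<le> x * y" using mult_left_mono[of r x y] that xy by (simp add: mult.commute)
    ultimately have "n * (x * y) < 2 * (x * y)" using that by linarith
    then have "n < 2" using xy by (subst (asm) mult_less_cancel_right_pos) auto
    then show "n \<le> 1" by simp
    assume "n \<le> 0"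
    then have "n * (x * y) \<le> 0" using xy by (simp add: mult_nonpos_nonneg)
    moreover have "x * 1 \<le> x * q" "y * 1 \<le> y * r" using that xy by (auto intro!: mult_left_mono)
    ultimately show "x + y \<le> z" using that by linarith
  qed
  have "n3 \<le> 1" "n3 \<le> 0 \<Longrightarrow> p1 + p2 \<le> p3" using le[OF n3] big[OF n3] pos by auto
  moreover have "n1 \<le> 1" "n1 \<le> 0 \<Longrightarrow> p2 + p3 \<le> p1" using le[OF n1] big[OF n1] pos by auto
  moreover have "n2 \<le> 1" "n2 \<le> 0 \<Longrightarrow> p3 + p1 \<le> p2" using le[OF n2] big[OF n2] pos by auto
  ultimately show ?thesis using pos by linarith
qed

section \<open>Lattice bases of the plane\<close>

definition det2 :: "real^2 \<Rightarrow> real^2 \<Rightarrow> real" where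
  "det2 u v = u $ 1 * v $ 2 - u $ 2 * v $ 1"

lemma det2_simps [simp]:
  "det2 (u + v) w = det2 u w + det2 v w" "det2 w (u + v) = det2 w u + det2 w v"
  "det2 (u - v) w = det2 u w - det2 v w" "det2 w (u - v) = det2 w u - det2 w v"
  "det2 (t *\<^sub>R u) w = t * det2 u w" "det2 w (t *\<^sub>R u) = t * det2 w u"
  "det2 (- u) w = - det2 u w" "det2 w (- u) = - det2 w u" "det2 u u = 0"
  "det2 0 w = 0" "det2 w 0 = 0"
  by (simp_all add: det2_def algebra_simps)

lemma det2_swap: "det2 v u = - det2 u v"
  by (simp add: det2_def)

lemma Z2_iff: "x \<in> Z2 \<longleftrightarrow> x $ 1 \<in> \<int> \<and> x $ 2 \<in> \<int>"
  by (simp add: Z2_def forall_2)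

lemma Z2_closed [simp]:
  "0 \<in> Z2" "u \<in> Z2 \<Longrightarrow> v \<in> Z2 \<Longrightarrow> u + v \<in> Z2" "u \<in> Z2 \<Longrightarrow> v \<in> Z2 \<Longrightarrow> u - v \<in> Z2"
  "u \<in> Z2 \<Longrightarrow> - u \<in> Z2" "t \<in> \<int> \<Longrightarrow> u \<in> Z2 \<Longrightarrow> t *\<^sub>R u \<in> Z2"
  by (auto simp: Z2_iff)

lemma det2_Ints [simp]: "u \<in> Z2 \<Longrightarrow> v \<in> Z2 \<Longrightarrow> det2 u v \<in> \<int>"
  by (auto simp: Z2_iff det2_def)

lemma abs_one_mult_self: "\<bar>d\<bar> = 1 \<Longrightarrow> d * d = (1::real)"
  by (metis abs_mult_self_eq mult_1)

text \<open>Cramer's rule. The determinant is its own inverse, so no division occurs and the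
  coordinates of lattice vectors are visibly integers.\<close>

lemma basis_expand:
  assumes "\<bar>det2 v e\<bar> = 1"
  shows "x = (det2 v e * det2 x e) *\<^sub>R v + (det2 v e * det2 v x) *\<^sub>R e"
proof -
  define d where "d = det2 v e"
  have dd: "d * d = 1" using abs_one_mult_self assms by (simp add: d_def)
  have "det2 x e * v $ i + det2 v x * e $ i = d * x $ i" for i
    using exhaust_2[of i] by (auto simp: det2_def d_def algebra_simps)
  then have "d * (d * x $ i) = (d * det2 x e) * v $ i + (d * det2 v x) * e $ i" for i
    by (metis distrib_left mult.assoc)
  then have "x $ i = (d * det2 x e) * v $ i + (d * det2 v x) * e $ i" for i
    by (metis dd mult.assoc mult_1)
  then show ?thesis by (simp add: vec_eq_iff d_def)
qed

lemma basis_coords_unique: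
  assumes "det2 v e \<noteq> 0" "a *\<^sub>R v + b *\<^sub>R e = a' *\<^sub>R v + b' *\<^sub>R e"
  shows "a = a'" "b = b'"
proof -
  have "det2 (a *\<^sub>R v + b *\<^sub>R e) e = det2 (a' *\<^sub>R v + b' *\<^sub>R e) e"
    "det2 v (a *\<^sub>R v + b *\<^sub>R e) = det2 v (a' *\<^sub>R v + b' *\<^sub>R e)"
    by (simp_all only: assms(2))
  then show "a = a'" "b = b'" using assms(1) by simp_all
qed

lemma lattice_basisI:
  assumes "v \<in> Z2" "e \<in> Z2" "\<bar>det2 v e\<bar> = 1"
  shows "lattice_basis v e"
  unfolding lattice_basis_def
proof (intro conjI ballI assms)
  fix w assume w: "w \<in> Z2"
  obtain a b where ab: "det2 v e * det2 w e = of_int a" "det2 v e * det2 v w = of_int b"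
    by (metis Ints_cases Ints_mult det2_Ints assms(1,2) w)
  have e: "w = of_int a *\<^sub>R v + of_int b *\<^sub>R e"
    using basis_expand[OF assms(3), of w] ab by simp
  have nz: "det2 v e \<noteq> 0" using assms(3) by auto
  show "\<exists>!p :: int \<times> int. w = of_int (fst p) *\<^sub>R v + of_int (snd p) *\<^sub>R e"
  proof (rule ex1I[of _ "(a, b)"])
    fix p :: "int \<times> int"
    assume "w = of_int (fst p) *\<^sub>R v + of_int (snd p) *\<^sub>R e"
    then show "p = (a, b)" using basis_coords_unique[OF nz] e
      by (metis of_int_eq_iff prod.collapse)
  qed (simp add: e)
qed

text \<open>Expanding \<open>e\<close> in the basis \<open>v\<close>, \<open>f\<close> shows that
  the integer \<open>det2 v f\<close> divides 1 or -1.\<close>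

lemma lattice_basis_det:
  assumes "v \<in> Z2" "e \<in> Z2" "\<bar>det2 v e\<bar> = 1" "lattice_basis v f"
  shows "\<bar>det2 v f\<bar> = 1"
proof -
  have f: "f \<in> Z2" using assms(4) by (simp add: lattice_basis_def)
  obtain a b :: int where "e = of_int a *\<^sub>R v + of_int b *\<^sub>R f"
    using assms(2,4) unfolding lattice_basis_def by blast
  then have "det2 v e = of_int b * det2 v f" by simp
  moreover obtain m where m: "det2 v f = of_int m" using det2_Ints[OF assms(1) f] Ints_cases by blast
  ultimately have "\<bar>real_of_int (b * m)\<bar> = 1" using assms(3) by simp
  then have "\<bar>b * m\<bar> = 1" by linarith
  then have "\<bar>m\<bar> = 1" by (metis abs_zmult_eq_1 mult.commute)
  then show ?thesis using m by simp
qed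

section \<open>Primitive vectors\<close>

text \<open>If \<open>t *\<^sub>R w\<close> is a lattice point, then \<open>t * q\<close> and
  \<open>t * p\<close> are integers, and a Bezout combination of them shows that \<open>t\<close> is
  an integer.\<close>

lemma primitive_vectorI:
  assumes "v \<in> Z2" "e \<in> Z2" "\<bar>det2 v e\<bar> = 1" "coprime p q"
  shows "primitive_vector (of_int q *\<^sub>R v + of_int p *\<^sub>R e)"
proof -
  define w where "w = real_of_int q *\<^sub>R v + of_int p *\<^sub>R e"
  define d where "d = det2 v e"
  have dd: "d * d = 1" using abs_one_mult_self assms by (simp add: d_def)
  have d: "d \<in> \<int>" using assms by (simp add: d_def)
  have w: "w \<in> Z2" using assms by (simp add: w_def)
  have det: "det2 w e = of_int q * d" "det2 v w = of_int p * d" by (simp_all add: w_def d_def)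
  obtain a b where ab: "a * p + b * q = 1"
    using bezout_int[of p q] assms(4) by (metis coprime_iff_gcd_eq_1)
  have "w \<noteq> 0"
  proof
    assume "w = 0"
    then have "p = 0" "q = 0" using det dd by auto
    then show False using ab by simp
  qed
  moreover have "t *\<^sub>R w \<notin> Z2" if t: "0 < t" "t < 1" for t
  proof
    assume "t *\<^sub>R w \<in> Z2"
    then have "det2 (t *\<^sub>R w) e * d \<in> \<int>" "det2 v (t *\<^sub>R w) * d \<in> \<int>"
      using assms d det2_Ints by (auto intro!: Ints_mult simp del: det2_simps)
    moreover have "det2 (t *\<^sub>R w) e * d = t * of_int q" "det2 v (t *\<^sub>R w) * d = t * of_int p"
      by (simp_all only: det det2_simps mult.assoc dd mult_1_right)
    ultimately have "t * of_int q \<in> \<int>" "t * of_int p \<in> \<int>" by (simp_all only:)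
    then have "of_int a * (t * of_int p) + of_int b * (t * of_int q) \<in> \<int>"
      by (intro Ints_add Ints_mult[OF Ints_of_int])
    also have "of_int a * (t * of_int p) + of_int b * (t * of_int q) = t * of_int (a * p + b * q)"
      by (simp add: algebra_simps)
    finally have "t \<in> \<int>" by (simp add: ab)
    then show False using t by (auto elim!: Ints_cases)
  qed
  ultimately have "primitive_vector w"
    using w by (auto simp: primitive_vector_def in_segment)
  then show ?thesis by (simp add: w_def)
qed

text \<open>A factor below 1 puts \<open>w\<close> inside the open segment to \<open>v\<close>; a
  factor above 1 exchanges the roles, with factor \<open>1 / t\<close>.\<close>

lemma primitive_vector_unique:
  assumes "primitive_vector v" "primitive_vector w" "w = t *\<^sub>R v" "0 \<le> t"
  shows "w = v"
proof -
  have no: False if "primitive_vector x" "primitive_vector (s *\<^sub>R x)" "0 < s" "s < 1" for x s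
  proof -
    have "s *\<^sub>R x \<in> open_segment 0 x"
      using that by (auto simp: in_segment primitive_vector_def)
    then show False using that by (auto simp: primitive_vector_def)
  qed
  have t: "0 < t" using assms by (auto simp: primitive_vector_def less_le)
  have "v = (1 / t) *\<^sub>R w" using t assms by simp
  then have "\<not> t < 1" "\<not> 1 < t" using no[of v t] no[of w "1 / t"] assms t by auto
  then show ?thesis using assms by simp
qed

section \<open>The lattice type of an angle\<close>

lemma mem_ray_iff: "P + x \<in> ray P (P + w) \<longleftrightarrow> (\<exists>t\<ge>0. x = t *\<^sub>R w)"
  by (auto simp: ray_def)

lemma ray_scale:
  assumes "0 < k"
  shows "ray P (P + k *\<^sub>R w) = ray P (P + w)"
proof -
  have "\<exists>s\<ge>0. t *\<^sub>R k *\<^sub>R w = s *\<^sub>R w" "\<exists>s\<ge>0. t *\<^sub>R w = s *\<^sub>R k *\<^sub>R w" if "0 \<le> t" for t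
    using assms that by (auto intro: exI[of _ "t * k"] exI[of _ "t / k"])
  then show ?thesis by (fastforce simp: ray_def)
qed

lemma ray_eqD:
  assumes "ray P A = ray P (P + w)" "w \<noteq> 0"
  shows "\<exists>k>0. w = k *\<^sub>R (A - P)"
proof -
  have "P + w \<in> ray P A" using assms(1) mem_ray_iff[of P w w] by (auto intro: exI[of _ 1])
  then obtain k where "0 \<le> k" "w = k *\<^sub>R (A - P)" by (auto simp: ray_def)
  then show ?thesis using assms(2) by (intro exI[of _ k]) (auto simp: less_le)
qed

text \<open>The type \<open>(p, q)\<close> is the pair of lattice sine and lattice cosine.\<close>

definition has_lattice_type :: "angle \<Rightarrow> int \<Rightarrow> int \<Rightarrow> bool" where
  "has_lattice_type \<alpha> p q \<longleftrightarrow> 1 \<le> q \<and> q \<le> p \<and> coprime p q \<and>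
     (\<exists>P\<in>Z2. \<exists>v\<in>Z2. \<exists>e\<in>Z2. \<bar>det2 v e\<bar> = 1 \<and>
        \<alpha> = angle_at (P + v) P (P + (of_int q *\<^sub>R v + of_int p *\<^sub>R e)))"

lemma prim1_angle_at: "primitive_vector v \<Longrightarrow> prim1 (angle_at (P + v) P B) = v"
  unfolding prim1_def angle_at_def angle.sel
  by (rule the_equality) (auto simp: mem_ray_iff intro: primitive_vector_unique exI[of _ 1])

lemma prim2_angle_at: "primitive_vector w \<Longrightarrow> prim2 (angle_at A P (P + w)) = w"
  unfolding prim2_def angle_at_def angle.sel
  by (rule the_equality) (auto simp: mem_ray_iff intro: primitive_vector_unique exI[of _ 1])

lemma mem_line_iff_det2:
  assumes "w \<noteq> 0"
  shows "x \<in> affine hull {P, P + w} \<longleftrightarrow> det2 w (x - P) = 0"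
proof
  assume "x \<in> affine hull {P, P + w}"
  then obtain a b where "a + b = 1" "x = a *\<^sub>R P + b *\<^sub>R (P + w)" by (auto simp: affine_hull_2)
  then have "x - P = b *\<^sub>R w" by (simp add: algebra_simps flip: scaleR_add_left)
  then show "det2 w (x - P) = 0" by (simp del: det2_simps(3,4))
next
  assume d: "det2 w (x - P) = 0"
  define y where "y = x - P"
  have "\<exists>t. y = t *\<^sub>R w"
  proof (cases "w $ 1 = 0")
    case True
    then have "w $ 2 \<noteq> 0" using assms by (auto simp: vec_eq_iff forall_2)
    then show ?thesis using d True
      by (intro exI[of _ "y $ 2 / w $ 2"]) (auto simp: vec_eq_iff forall_2 det2_def y_def[symmetric])
  next
    case False
    then show ?thesis using d
      by (intro exI[of _ "y $ 1 / w $ 1"])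
        (auto simp: vec_eq_iff forall_2 det2_def y_def[symmetric] field_simps)
  qed
  then obtain t where "y = t *\<^sub>R w" by blast
  then have "x = (1 - t) *\<^sub>R P + t *\<^sub>R (P + w)" by (simp add: y_def algebra_simps)
  then show "x \<in> affine hull {P, P + w}" unfolding affine_hull_2
    by (intro CollectI exI[of _ "1 - t"] exI[of _ t]) simp
qed

text \<open>\<open>det2 w (z - P)\<close> is affine in \<open>z\<close> and vanishes exactly on the
  line, so a segment between points off the line crosses it precisely when the sign changes.\<close>

lemma strictly_opposite_iff_det2:
  assumes "w \<noteq> 0"
  shows "strictly_opposite (affine hull {P, P + w}) x y \<longleftrightarrow>
    det2 w (x - P) * det2 w (y - P) < 0"
proof -
  define f where "f z = det2 w (z - P)" for z
  have f: "f ((1 - u) *\<^sub>R x + u *\<^sub>R y) = (1 - u) * f x + u * f y" for u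
    by (simp add: f_def algebra_simps)
  have "(\<exists>u. 0 \<le> u \<and> u \<le> 1 \<and> (1 - u) * f x + u * f y = 0) \<longleftrightarrow> f x * f y < 0"
    if nz: "f x \<noteq> 0" "f y \<noteq> 0"
  proof
    assume "\<exists>u. 0 \<le> u \<and> u \<le> 1 \<and> (1 - u) * f x + u * f y = 0"
    then obtain u where u: "0 \<le> u" "u \<le> 1" "(1 - u) * f x = - (u * f y)"
      by (auto simp: add_eq_0_iff2)
    have "u \<noteq> 0" using u nz by auto
    \<comment> \<open>Multiplying by \<open>f x\<close> makes the left side a square with a
      nonnegative factor, which determines the sign of \<open>f x * f y\<close>.\<close>
    have "(1 - u) * (f x * f x) = - (u * (f x * f y))"
      using arg_cong[OF u(3), of "\<lambda>z. z * f x"] by (simp add: mult_ac)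
    moreover have "0 \<le> (1 - u) * (f x * f x)" using u by simp
    ultimately have "u * (f x * f y) \<le> 0" by simp
    then have "f x * f y \<le> 0" using u \<open>u \<noteq> 0\<close> by (simp add: mult_le_0_iff)
    moreover have "f x * f y \<noteq> 0" using nz by simp
    ultimately show "f x * f y < 0" by linarith
  next
    assume a: "f x * f y < 0"
    then have "f x - f y \<noteq> 0" by (auto simp: mult_less_0_iff)
    then have "(1 - f x / (f x - f y)) * f x + f x / (f x - f y) * f y = 0"
      by (simp add: field_simps)
    moreover have "0 \<le> f x / (f x - f y)" "f x / (f x - f y) \<le> 1"
      using a by (auto simp: mult_less_0_iff field_simps)
    ultimately show "\<exists>u. 0 \<le> u \<and> u \<le> 1 \<and> (1 - u) * f x + u * f y = 0" by blast
  qed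
  moreover have "strictly_opposite (affine hull {P, P + w}) x y \<longleftrightarrow> f x \<noteq> 0 \<and> f y \<noteq> 0 \<and>
      (\<exists>u. 0 \<le> u \<and> u \<le> 1 \<and> (1 - u) * f x + u * f y = 0)"
    unfolding strictly_opposite_def mem_line_iff_det2[OF assms] closed_segment_def
      disjoint_iff f[symmetric]
    by (auto simp: mem_line_iff_det2[OF assms] f_def)
  moreover have "f x * f y < 0 \<Longrightarrow> f x \<noteq> 0 \<and> f y \<noteq> 0" by auto
  ultimately have "strictly_opposite (affine hull {P, P + w}) x y \<longleftrightarrow> f x * f y < 0" by blast
  then show ?thesis by (simp only: f_def)
qed

section \<open>Lattice sine, cosine and tangent read off from the type\<close>

text \<open>The definite descriptions are evaluated in turn: the line runs through
  \<open>P + e\<close> in direction \<open>v\<close>, the ray meets it at offset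
  \<open>q / p\<close>, and \<open>D\<close> is \<open>P + e\<close>. The range
  \<open>0 < q / p \<le> 1\<close> makes 0 the largest integer offset strictly below the meeting
  point.\<close>

lemma lcos_lsin_basis_angle:
  assumes "v \<in> Z2" "e \<in> Z2" "P \<in> Z2" "\<bar>det2 v e\<bar> = 1" "1 \<le> q" "q \<le> p" "coprime p q"
  defines "\<alpha> \<equiv> angle_at (P + v) P (P + (of_int q *\<^sub>R v + of_int p *\<^sub>R e))"
  shows "lcos_lsin \<alpha> = (q, p)"
proof -
  define w where "w = real_of_int q *\<^sub>R v + of_int p *\<^sub>R e"
  define d where "d = det2 v e"
  have nz: "d \<noteq> 0" and dd: "d * d = 1" using assms(4) abs_one_mult_self by (auto simp: d_def)
  have p: "0 < real_of_int p" "0 < real_of_int q" "real_of_int q \<le> of_int p" using assms by auto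
  have prv: "primitive_vector v" using primitive_vectorI[OF assms(1,2,4), of 0 1] by simp
  have prw: "primitive_vector w" using primitive_vectorI[OF assms(1,2,4,7)] by (simp add: w_def)
  have wnz: "w \<noteq> 0" using prw by (simp add: primitive_vector_def)
  have vnz: "v \<noteq> 0" using prv by (simp add: primitive_vector_def)
  have \<alpha>: "\<alpha> = angle_at (P + v) P (P + w)" by (simp add: \<alpha>_def w_def)
  have v1: "prim1 \<alpha> = v" and v2: "prim2 \<alpha> = w"
    using prim1_angle_at[OF prv] prim2_angle_at[OF prw] by (simp_all add: \<alpha>)
  have sel: "vertex \<alpha> = P" "ray2 \<alpha> = ray P (P + w)" by (simp_all add: \<alpha> angle_at_def)
  have detw: "det2 v w = of_int p * d" "det2 w v = - of_int p * d" "det2 w e = of_int q * d"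
    using det2_swap[of v e] by (simp_all add: w_def d_def)
  have meet: "P + (e + (of_int q / of_int p) *\<^sub>R v) \<in> ray P (P + w)"
    unfolding mem_ray_iff using p by (intro exI[of _ "1 / of_int p"])
      (simp add: w_def scaleR_right_distrib)
  define L where "L = {P + e + t *\<^sub>R v | t. t \<in> UNIV}"
  have L: "tangent_line \<alpha> = L"
    unfolding tangent_line_def v1 sel
  proof (rule the_equality, intro conjI exI[of _ "P + e"])
    show "lattice_basis v (P + e - P)" using lattice_basisI assms by simp
    show "P + e \<in> Z2" using assms by simp
    show "L = {P + e + t *\<^sub>R v |t. t \<in> UNIV}" by (simp add: L_def)
    have "P + (e + (of_int q / of_int p) *\<^sub>R v) \<in> L" by (auto simp: L_def)
    then show "L \<inter> ray P (P + w) \<noteq> {}" using meet by blast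
  next
    fix l
    assume "(\<exists>P'. lattice_basis v (P' - P) \<and> P' \<in> Z2 \<and> l = {P' + t *\<^sub>R v |t. t \<in> UNIV}) \<and>
      l \<inter> ray P (P + w) \<noteq> {}"
    then obtain P' where P': "lattice_basis v (P' - P)" "l = {P' + t *\<^sub>R v |t. t \<in> UNIV}"
      and ne: "l \<inter> ray P (P + w) \<noteq> {}" by blast
    define f where "f = P' - P"
    obtain t s where s: "0 \<le> s" "P' + t *\<^sub>R v = P + s *\<^sub>R w"
      using ne P'(2) by (auto simp: ray_def)
    then have "f = s *\<^sub>R w - t *\<^sub>R v" by (simp add: f_def algebra_simps)
    \<comment> \<open>The two candidate lines differ in the sign of \<open>det2 v f\<close>; since
      \<open>s\<close> is nonnegative, meeting the ray forces the sign \<open>d\<close>, hence the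
      line through \<open>P + e\<close>.\<close>
    then have df: "det2 v f = s * of_int p * d" by (simp add: detw)
    moreover have "\<bar>det2 v f\<bar> = 1"
      unfolding f_def by (rule lattice_basis_det[OF assms(1,2,4) P'(1)])
    ultimately have "s * of_int p = 1" using s p assms(4) by (simp add: abs_mult d_def)
    then have "det2 v f = d" using df by simp
    then have f: "f = (d * det2 f e) *\<^sub>R v + e"
      using basis_expand[OF assms(4), of f] dd by (simp add: d_def)
    show "l = L"
    proof -
      have "P' + t *\<^sub>R v = P + e + (t + d * det2 f e) *\<^sub>R v" for t
        using f by (simp add: f_def algebra_simps)
      moreover have "P + e + t *\<^sub>R v = P' + (t - d * det2 f e) *\<^sub>R v" for t
        using f by (simp add: f_def algebra_simps)
      ultimately show ?thesis unfolding L_def P'(2) by (metis (no_types, lifting) UNIV_I)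
    qed
  qed
  define Q where "Q = P + e + (of_int q / of_int p) *\<^sub>R v"
  have Q: "tangent_meet \<alpha> = Q"
    unfolding tangent_meet_def L sel
  proof (rule the_equality)
    show "Q \<in> L \<inter> ray P (P + w)" using meet by (auto simp: Q_def L_def add.assoc)
    fix x assume "x \<in> L \<inter> ray P (P + w)"
    then obtain t s where x: "x = P + e + t *\<^sub>R v" "x = P + s *\<^sub>R w"
      unfolding L_def ray_def by fastforce
    then have "t *\<^sub>R v + 1 *\<^sub>R e = (s * of_int q) *\<^sub>R v + (s * of_int p) *\<^sub>R e"
      by (simp add: w_def algebra_simps)
    then have "t = s * of_int q" "1 = s * of_int p"
      using basis_coords_unique nz unfolding d_def by blast+
    then have "t = of_int q / of_int p" using p by (simp add: field_simps)
    then show "x = Q" using x by (simp add: Q_def)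
  qed
  have opp: "strictly_opposite (affine hull {P, P + w}) (P + v) (P + e + t *\<^sub>R v) \<longleftrightarrow>
      t * of_int p < of_int q" for t
  proof -
    have "det2 w (P + v - P) * det2 w (P + e + t *\<^sub>R v - P) =
        - (of_int p * (of_int q - t * of_int p)) * (d * d)"
      by (simp add: detw algebra_simps)
    then show ?thesis
      unfolding strictly_opposite_iff_det2[OF wnz] using p dd by (simp add: zero_less_mult_iff)
  qed
  \<comment> \<open>An integer \<open>m\<close> with \<open>m * p < q \<le> p\<close> is at most 0.
    When \<open>q = p\<close>, the offset 1 is on the second arm itself and strictness excludes
    it.\<close>
  have adm: "(x \<in> Z2 \<inter> L \<and> strictly_opposite (affine hull {P, P + w}) (P + v) x) \<longleftrightarrow>
      (\<exists>m::int. m \<le> 0 \<and> x = P + e + of_int m *\<^sub>R v)" for x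
  proof
    assume a: "x \<in> Z2 \<inter> L \<and> strictly_opposite (affine hull {P, P + w}) (P + v) x"
    then obtain t where t: "x = P + e + t *\<^sub>R v" by (auto simp: L_def)
    have "x - P - e \<in> Z2" using a assms by simp
    then have "det2 (x - P - e) e * d \<in> \<int>"
      using assms by (intro Ints_mult det2_Ints) (auto simp: d_def)
    moreover have "det2 (x - P - e) e * d = t" using dd by (simp add: t d_def mult.assoc)
    ultimately obtain m where m: "t = of_int m" by (auto elim: Ints_cases)
    have "of_int m * real_of_int p < of_int q" using a t m opp by simp
    then have "of_int (m * p) < real_of_int q" by simp
    then have "m * p < q" by (simp only: of_int_less_iff)
    then have "m * p < 1 * p" using assms by linarith
    then have "m < 1" using assms by (subst (asm) mult_less_cancel_right_pos) auto
    then show "\<exists>m::int. m \<le> 0 \<and> x = P + e + of_int m *\<^sub>R v" using t m by (intro exI[of _ m]) auto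
  next
    assume "\<exists>m::int. m \<le> 0 \<and> x = P + e + of_int m *\<^sub>R v"
    then obtain m :: int where m: "m \<le> 0" "x = P + e + of_int m *\<^sub>R v" by blast
    have "of_int m * real_of_int p \<le> 0" using m p by (simp add: mult_nonpos_nonneg)
    then have "of_int m * real_of_int p < of_int q" using p by linarith
    then show "x \<in> Z2 \<inter> L \<and> strictly_opposite (affine hull {P, P + w}) (P + v) x"
      using m opp assms by (auto simp: L_def)
  qed
  have dist: "dist Q (P + e + t *\<^sub>R v) = \<bar>of_int q / of_int p - t\<bar> * norm v" for t
  proof -
    have "Q - (P + e + t *\<^sub>R v) = (of_int q / of_int p - t) *\<^sub>R v"
      by (simp add: Q_def algebra_simps)
    then show ?thesis by (simp add: dist_norm)
  qed
  have "0 < real_of_int q / of_int p" using p by simp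
  \<comment> \<open>For \<open>m \<le> 0\<close> the distance factor is \<open>q / p - m\<close>,
    which decreases as \<open>m\<close> grows, so \<open>m = 0\<close> is the unique
    minimiser.\<close>
  then have less_iff: "dist Q (P + e + of_int m *\<^sub>R v) < dist Q (P + e + of_int m' *\<^sub>R v) \<longleftrightarrow> m' < m"
    if "m \<le> 0" "m' \<le> 0" for m m' :: int
    unfolding dist using that vnz by (auto simp: abs_if)
  have D: "tangent_point \<alpha> = P + e"
    unfolding tangent_point_def v1 v2 sel L Q adm
  proof (rule the_equality)
    show "is_arg_min (dist Q) (\<lambda>x. \<exists>m::int\<le>0. x = P + e + of_int m *\<^sub>R v) (P + e)"
      unfolding is_arg_min_def
    proof (intro conjI notI)
      show "\<exists>m::int\<le>0. P + e = P + e + of_int m *\<^sub>R v" by (rule exI[of _ 0]) simp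
      assume "\<exists>y. (\<exists>m::int\<le>0. y = P + e + of_int m *\<^sub>R v) \<and> dist Q y < dist Q (P + e)"
      then obtain m :: int where "m \<le> 0" "dist Q (P + e + of_int m *\<^sub>R v) < dist Q (P + e)" by blast
      then show False using less_iff[of m 0] by simp
    qed
    fix x assume "is_arg_min (dist Q) (\<lambda>x. \<exists>m::int\<le>0. x = P + e + of_int m *\<^sub>R v) x"
    then obtain m :: int where m: "m \<le> 0" "x = P + e + of_int m *\<^sub>R v"
      and min: "\<not> dist Q (P + e + of_int 0 *\<^sub>R v) < dist Q x"
      unfolding is_arg_min_def by blast
    then have "m = 0" using less_iff[of 0 m] by auto
    then show "x = P + e" using m by simp
  qed
  show ?thesis
    unfolding lcos_lsin_def v1 v2 sel D
  proof (rule the_equality)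
    show "w = of_int (fst (q, p)) *\<^sub>R v + of_int (snd (q, p)) *\<^sub>R (P + e - P)" by (simp add: w_def)
    fix x :: "int \<times> int"
    assume "w = of_int (fst x) *\<^sub>R v + of_int (snd x) *\<^sub>R (P + e - P)"
    then have "of_int (fst x) *\<^sub>R v + of_int (snd x) *\<^sub>R e = of_int q *\<^sub>R v + of_int p *\<^sub>R e"
      by (simp add: w_def)
    then have "real_of_int (fst x) = of_int q" "real_of_int (snd x) = of_int p"
      using basis_coords_unique nz unfolding d_def by blast+
    then show "x = (q, p)" by (simp add: prod_eq_iff)
  qed
qed

lemma ltan_eq_type:
  assumes "has_lattice_type \<alpha> p q"
  shows "ltan \<alpha> = of_int p / of_int q"
proof -
  have "lcos_lsin \<alpha> = (q, p)"
    using assms lcos_lsin_basis_angle unfolding has_lattice_type_def by blast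
  then show ?thesis by (simp add: ltan_def lcos_def lsin_def)
qed

section \<open>Congruence of angles through unimodular maps\<close>

lemma invertible_int_mat2:
  fixes M :: "int^2^2"
  assumes "\<bar>det M\<bar> = 1"
  shows "invertible M"
proof -
  \<comment> \<open>The adjugate times the determinant, which is its own inverse.\<close>
  define M' :: "int^2^2" where
    "M' = (\<chi> i j. det M * (if i = j then (if i = 1 then M $ 2 $ 2 else M $ 1 $ 1) else - M $ i $ j))"
  have "det M * det M = 1" by (metis assms abs_mult_self_eq mult_1)
  then have dd: "det M * (M $ 1 $ 1 * M $ 2 $ 2 - M $ 1 $ 2 * M $ 2 $ 1) = 1" by (simp add: det_2)
  have "M ** M' = mat 1" "M' ** M = mat 1"
    using dd
    by (auto simp: M'_def matrix_matrix_mult_def vec_eq_iff forall_2 sum_2 mat_def algebra_simps)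
  then show ?thesis unfolding invertible_def by blast
qed

lemma abs_det_invertible_int:
  fixes M :: "int^'n^'n"
  assumes "invertible M"
  shows "\<bar>det M\<bar> = 1"
proof -
  obtain M' where "M ** M' = mat 1" using assms by (auto simp: invertible_def)
  then have "det M * det M' = 1" by (metis det_mul det_I)
  then show ?thesis by (metis abs_zmult_eq_1 abs_1)
qed

lemma lattice_affine_ray_image:
  assumes "lattice_affine f"
  shows "f ` ray P A = ray (f P) (f A)"
proof -
  obtain M b where f: "f = (\<lambda>x. map_matrix real_of_int M *v x + b)"
    using assms by (auto simp: lattice_affine_def)
  have "f (P + t *\<^sub>R (A - P)) = f P + t *\<^sub>R (f A - f P)" for t
    by (simp add: f matrix_vector_right_distrib matrix_vector_mult_diff_distrib
        matrix_vector_mult_scaleR algebra_simps)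
  moreover have "ray X Y = (\<lambda>t. X + t *\<^sub>R (Y - X)) ` {0..}" for X Y by (auto simp: ray_def)
  ultimately show ?thesis by (simp add: image_image)
qed

lemma lattice_affine_angle_at:
  assumes "lattice_affine f" "f P = P'" "f A = A'" "f B = B'"
  shows "lattice_congruent (angle_at A P B) (angle_at A' P' B')"
  unfolding lattice_congruent_def angle_at_def angle.sel assms(2-4)[symmetric]
  using assms(1) lattice_affine_ray_image[OF assms(1)] by blast

lemma lattice_affine_between_bases:
  assumes "P \<in> Z2" "v \<in> Z2" "e \<in> Z2" "\<bar>det2 v e\<bar> = 1"
    "P' \<in> Z2" "v' \<in> Z2" "e' \<in> Z2" "\<bar>det2 v' e'\<bar> = 1"
  obtains f where "lattice_affine f"
    "\<And>x y. f (P + (x *\<^sub>R v + y *\<^sub>R e)) = P' + (x *\<^sub>R v' + y *\<^sub>R e')"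
proof -
  define d where "d = det2 v e"
  have dd: "d * d = 1" using abs_one_mult_self assms by (simp add: d_def)
  have d: "d \<in> \<int>" using assms by (simp add: d_def)
  \<comment> \<open>The columns are the images of the standard basis vectors: their Cramer
    coordinates in \<open>v\<close>, \<open>e\<close> are transferred to \<open>v'\<close>,
    \<open>e'\<close>. Since \<open>d\<close> is 1 or -1, all entries are integers, and the floors
    in \<open>M\<close> lose nothing.\<close>
  define R :: "real^2^2" where "R = (\<chi> i j. if j = 1 then d * (e $ 2 * v' $ i - v $ 2 * e' $ i)
      else d * (v $ 1 * e' $ i - e $ 1 * v' $ i))"
  define M :: "int^2^2" where "M = (\<chi> i j. \<lfloor>R $ i $ j\<rfloor>)"
  have "R $ i $ j \<in> \<int>" for i j
    using assms d exhaust_2[of i] by (auto simp: R_def Z2_iff)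
  then have MR: "map_matrix real_of_int M = R"
    by (simp add: M_def map_matrix_def vec_eq_iff)
  have R: "R *v x = (d * det2 x e) *\<^sub>R v' + (d * det2 v x) *\<^sub>R e'" for x
    by (simp add: R_def matrix_vector_mult_def vec_eq_iff forall_2 sum_2 det2_def algebra_simps)
  have "R $ 1 $ 1 * R $ 2 $ 2 - R $ 1 $ 2 * R $ 2 $ 1 = (d * d) * det2 v e * det2 v' e'"
    by (simp add: R_def det2_def algebra_simps)
  then have "of_int (det M) = det2 v e * det2 v' e'"
    by (simp add: det_2 dd map_matrix_def flip: MR)
  then have "\<bar>real_of_int (det M)\<bar> = 1" using assms by (simp add: abs_mult)
  then have inv: "invertible M" by (intro invertible_int_mat2) linarith
  define b where "b = P' - R *v P"
  have "R *v P \<in> Z2" unfolding R using assms d by simp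
  then have b: "b \<in> Z2" using assms by (simp add: b_def)
  show thesis
  proof (rule that[of "\<lambda>x. R *v x + b"])
    show "lattice_affine (\<lambda>x. R *v x + b)"
      unfolding lattice_affine_def using inv b MR by blast
    fix x y
    have "R *v v = v'" "R *v e = e'" using dd by (simp_all add: R d_def[symmetric])
    then show "R *v (P + (x *\<^sub>R v + y *\<^sub>R e)) + b = P' + (x *\<^sub>R v' + y *\<^sub>R e')"
      by (simp add: b_def matrix_vector_right_distrib matrix_vector_mult_scaleR)
  qed
qed

lemma lattice_congruent_same_type:
  assumes "has_lattice_type \<alpha> p q" "has_lattice_type \<beta> p q"
  shows "lattice_congruent \<alpha> \<beta>"
proof -
  obtain P v e where \<alpha>: "P \<in> Z2" "v \<in> Z2" "e \<in> Z2" "\<bar>det2 v e\<bar> = 1"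
    "\<alpha> = angle_at (P + v) P (P + (of_int q *\<^sub>R v + of_int p *\<^sub>R e))"
    using assms(1) unfolding has_lattice_type_def by blast
  obtain P' v' e' where \<beta>: "P' \<in> Z2" "v' \<in> Z2" "e' \<in> Z2" "\<bar>det2 v' e'\<bar> = 1"
    "\<beta> = angle_at (P' + v') P' (P' + (of_int q *\<^sub>R v' + of_int p *\<^sub>R e'))"
    using assms(2) unfolding has_lattice_type_def by blast
  obtain f where f: "lattice_affine f"
    "\<And>x y. f (P + (x *\<^sub>R v + y *\<^sub>R e)) = P' + (x *\<^sub>R v' + y *\<^sub>R e')"
    using lattice_affine_between_bases[OF \<alpha>(1-4) \<beta>(1-4)] by blast
  show ?thesis unfolding \<alpha> \<beta>
    using f(2)[of 0 0] f(2)[of 1 0] f(2) by (intro lattice_affine_angle_at[OF f(1)]) simp_all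
qed

text \<open>An integer matrix of determinant 1 or -1 carries a unimodular basis to another one, and
  linearity preserves the coordinates \<open>q\<close>, \<open>p\<close> of the second arm.\<close>

lemma has_lattice_type_congruent:
  assumes "has_lattice_type \<alpha> p q" "lattice_congruent \<alpha> \<beta>"
  shows "has_lattice_type \<beta> p q"
proof -
  obtain P v e where \<alpha>: "P \<in> Z2" "v \<in> Z2" "e \<in> Z2" "\<bar>det2 v e\<bar> = 1"
    "\<alpha> = angle_at (P + v) P (P + (of_int q *\<^sub>R v + of_int p *\<^sub>R e))"
    using assms(1) unfolding has_lattice_type_def by blast
  obtain f where f: "lattice_affine f" "f (vertex \<alpha>) = vertex \<beta>"
      "f ` ray1 \<alpha> = ray1 \<beta>" "f ` ray2 \<alpha> = ray2 \<beta>"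
    using assms(2) by (auto simp: lattice_congruent_def)
  obtain M b where M: "f = (\<lambda>x. map_matrix real_of_int M *v x + b)" "invertible M" "b \<in> Z2"
    using f(1) by (auto simp: lattice_affine_def)
  define R where "R = map_matrix real_of_int M"
  have RZ: "R *v x \<in> Z2" if "x \<in> Z2" for x
    using that by (auto simp: Z2_iff R_def map_matrix_def matrix_vector_mult_def sum_2)
  have "det2 (R *v x) (R *v y) = of_int (det M) * det2 x y" for x y
    by (simp add: R_def map_matrix_def matrix_vector_mult_def sum_2 det2_def det_2 algebra_simps)
  then have det: "\<bar>det2 (R *v v) (R *v e)\<bar> = 1"
    using abs_det_invertible_int[OF M(2)] \<alpha>(4)
    by (simp add: abs_mult flip: of_int_abs)
  define P' where "P' = f P"
  have P': "P' \<in> Z2" using RZ[OF \<alpha>(1)] M by (simp add: P'_def R_def)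
  have fv: "f (P + x) = P' + R *v x" for x
    by (simp add: P'_def M R_def matrix_vector_right_distrib)
  have "\<beta> = angle_at (f (P + v)) P' (f (P + (of_int q *\<^sub>R v + of_int p *\<^sub>R e)))"
    using f lattice_affine_ray_image[OF f(1)]
    by (cases \<beta>) (simp add: \<alpha>(5) angle_at_def P'_def)
  also have "\<dots> = angle_at (P' + R *v v) P' (P' + (of_int q *\<^sub>R (R *v v) + of_int p *\<^sub>R (R *v e)))"
    unfolding fv by (simp add: matrix_vector_right_distrib matrix_vector_mult_scaleR)
  finally show ?thesis
    using assms(1) P' RZ[OF \<alpha>(2)] RZ[OF \<alpha>(3)] det unfolding has_lattice_type_def by blast
qed

section \<open>Types of angles given by points\<close>

lemma collinear_iff_det2: "collinear {A, B, C} \<longleftrightarrow> det2 (A - B) (C - B) = 0"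
proof (cases "A = B")
  case True
  then show ?thesis by (simp add: collinear_2)
next
  case False
  have "collinear {A, B, C} \<longleftrightarrow> collinear {B, A, C}" by (simp add: insert_commute)
  also have "\<dots> \<longleftrightarrow> C \<in> affine hull {B, A}" using False by (simp add: collinear_3_affine_hull)
  also have "\<dots> \<longleftrightarrow> C \<in> affine hull {B, B + (A - B)}" by simp
  also have "\<dots> \<longleftrightarrow> det2 (A - B) (C - B) = 0" using False by (subst mem_line_iff_det2) auto
  finally show ?thesis .
qed

text \<open>Dividing by the gcd leaves coprime coordinates, and their Bezout coefficients supply a
  vector completing a basis.\<close>

lemma Z2_primitive_multiple:
  assumes "x \<in> Z2" "x \<noteq> 0"
  obtains k and v e where "0 < k" "x = k *\<^sub>R v" "v \<in> Z2" "e \<in> Z2" "det2 v e = 1"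
proof -
  obtain a b where ab: "x $ 1 = of_int a" "x $ 2 = of_int b"
    using assms(1) unfolding Z2_iff by (auto elim!: Ints_cases)
  define g where "g = gcd a b"
  have "\<not> (a = 0 \<and> b = 0)" using assms(2) ab by (auto simp: vec_eq_iff forall_2)
  then have g: "0 < g" by (simp add: g_def)
  obtain a' b' where a': "a = g * a'" "b = g * b'" unfolding g_def by (metis dvdE gcd_dvd1 gcd_dvd2)
  obtain s t where "s * a + t * b = g" using bezout_int g_def by blast
  then have "g * (s * a' + t * b') = g * 1" by (simp add: a' algebra_simps)
  then have st: "s * a' + t * b' = 1" using g by simp
  define v :: "real^2" where "v = vector [of_int a', of_int b']"
  define e :: "real^2" where "e = vector [- of_int t, of_int s]"
  show thesis
  proof (rule that[of "of_int g" v e])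
    show "0 < real_of_int g" using g by simp
    show "x = of_int g *\<^sub>R v" by (simp add: vec_eq_iff forall_2 v_def ab a')
    show "v \<in> Z2" "e \<in> Z2" by (simp_all add: Z2_iff v_def e_def)
    have "det2 v e = of_int (s * a' + t * b')" by (simp add: det2_def v_def e_def)
    then show "det2 v e = 1" by (simp add: st)
  qed
qed

text \<open>After completing \<open>v\<close> to a basis, two normalisations remain: the sign of the
  second basis vector makes the sine positive, and a shear along \<open>v\<close> brings the cosine
  into range.\<close>

lemma ordinary_lattice_angle_type:
  assumes "ordinary_lattice_angle \<alpha>"
  obtains p q where "has_lattice_type \<alpha> p q"
proof -
  obtain A P B where Z: "A \<in> Z2" "P \<in> Z2" "B \<in> Z2" and nc: "\<not> collinear {A, P, B}"
    and \<alpha>: "\<alpha> = angle_at A P B"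
    using assms unfolding ordinary_lattice_angle_def by blast
  have nz: "det2 (A - P) (B - P) \<noteq> 0" using nc by (simp only: collinear_iff_det2 not_False_eq_True)
  then have ne: "A - P \<noteq> 0" "B - P \<noteq> 0" by auto
  obtain k v e where v: "0 < k" "A - P = k *\<^sub>R v" "v \<in> Z2" "e \<in> Z2" "det2 v e = 1"
    using Z2_primitive_multiple[OF _ ne(1)] Z by (metis Z2_closed(3))
  obtain l w f where w: "0 < l" "B - P = l *\<^sub>R w" "w \<in> Z2" "f \<in> Z2" "det2 w f = 1"
    using Z2_primitive_multiple[OF _ ne(2)] Z by (metis Z2_closed(3))
  have vw: "det2 v w \<noteq> 0" using nz unfolding v(2) w(2) by auto
  define \<epsilon> where "\<epsilon> = sgn (det2 v w) *\<^sub>R e"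
  have s: "sgn (det2 v w) \<in> \<int>" "\<bar>sgn (det2 v w)\<bar> = 1" using vw by (auto simp: sgn_if)
  have \<epsilon>: "\<epsilon> \<in> Z2" "\<bar>det2 v \<epsilon>\<bar> = 1" "det2 v \<epsilon> = sgn (det2 v w)"
    using s v by (simp_all add: \<epsilon>_def)
  obtain x y where xy: "det2 v \<epsilon> * det2 w \<epsilon> = of_int x" "det2 v \<epsilon> * det2 v w = of_int y"
    by (metis Ints_cases Ints_mult det2_Ints v(3) w(3) \<epsilon>(1))
  have we: "w = of_int x *\<^sub>R v + of_int y *\<^sub>R \<epsilon>"
    using basis_expand[OF \<epsilon>(2), of w] xy by simp
  have "real_of_int y = \<bar>det2 v w\<bar>" using xy(2) \<epsilon>(3) by (simp add: sgn_if split: if_splits)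
  then have "0 < real_of_int y" using vw by simp
  then have y: "0 < y" by simp
  \<comment> \<open>The shifted remainder runs from 1 to \<open>y\<close> instead of 0 to
    \<open>y - 1\<close>, so the cosine is never 0 and the type is \<open>(1, 1)\<close> when
    \<open>y = 1\<close>.\<close>
  define q m where "q = (x - 1) mod y + 1" and "m = (x - 1) div y"
  have x: "x = q + m * y" unfolding q_def m_def by simp
  have q: "1 \<le> q" "q \<le> y" using y by (auto simp: q_def add1_zle_eq)
  define e' where "e' = \<epsilon> + of_int m *\<^sub>R v"
  have e': "e' \<in> Z2" "\<bar>det2 v e'\<bar> = 1" using \<epsilon> v by (simp_all add: e'_def)
  have we': "w = of_int q *\<^sub>R v + of_int y *\<^sub>R e'"
    by (simp add: we x e'_def algebra_simps)
  \<comment> \<open>A common divisor of the coordinates of \<open>w\<close> divides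
    \<open>det2 w f\<close>, which is 1.\<close>
  have "coprime y q"
  proof (rule coprimeI)
    fix c assume c: "c dvd y" "c dvd q"
    obtain y' q' where c': "y = c * y'" "q = c * q'" using c by (metis dvdE)
    have "1 = of_int c * (of_int q' * det2 v f + of_int y' * det2 e' f)"
      using w(5) by (simp add: we' c' algebra_simps)
    moreover obtain n where "of_int q' * det2 v f + of_int y' * det2 e' f = of_int n"
      by (metis Ints_cases Ints_add Ints_mult Ints_of_int det2_Ints v(3) w(4) e'(1))
    ultimately have "1 = real_of_int (c * n)" by simp
    then have "c * n = 1" by linarith
    then show "is_unit c" by (metis dvd_triv_left)
  qed
  moreover have "\<alpha> = angle_at (P + v) P (P + w)"
    using ray_scale[OF v(1), of P v] ray_scale[OF w(1), of P w]
    by (simp add: \<alpha> angle_at_def flip: v(2) w(2))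
  ultimately have "has_lattice_type \<alpha> y q"
    unfolding has_lattice_type_def using q Z v e' we' by blast
  then show thesis by (rule that)
qed

lemma has_lattice_type_angle_atI:
  assumes "P \<in> Z2" "v \<in> Z2" "e \<in> Z2" "\<bar>det2 v e\<bar> = 1" "1 \<le> q" "q \<le> p" "coprime p q"
    "0 < k" "0 < l" "A - P = k *\<^sub>R v" "B - P = l *\<^sub>R (of_int q *\<^sub>R v + of_int p *\<^sub>R e)"
  shows "has_lattice_type (angle_at A P B) p q"
proof -
  have "A = P + k *\<^sub>R v" "B = P + l *\<^sub>R (of_int q *\<^sub>R v + of_int p *\<^sub>R e)"
    using assms(10,11) by (simp_all add: algebra_simps)
  then have "angle_at A P B = angle_at (P + v) P (P + (of_int q *\<^sub>R v + of_int p *\<^sub>R e))"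
    by (simp only: angle_at_def ray_scale[OF assms(8)] ray_scale[OF assms(9)])
  then show ?thesis unfolding has_lattice_type_def using assms by blast
qed

text \<open>Besides directions along the actual sides, this extracts that the sign of the basis is
  the orientation of the three points, which lets the angles of one triangle be compared.\<close>

lemma has_lattice_type_angle_atD:
  assumes "has_lattice_type (angle_at A P B) p q"
  obtains v e k l where "v \<in> Z2" "e \<in> Z2" "\<bar>det2 v e\<bar> = 1" "det2 v e = sgn (det2 (A - P) (B - P))"
    "0 < k" "0 < l" "v = k *\<^sub>R (A - P)" "of_int q *\<^sub>R v + of_int p *\<^sub>R e = l *\<^sub>R (B - P)"
    "primitive_vector v" "primitive_vector (of_int q *\<^sub>R v + of_int p *\<^sub>R e)"
proof -
  obtain v e where v: "v \<in> Z2" "e \<in> Z2" "\<bar>det2 v e\<bar> = 1"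
    and eq: "angle_at A P B = angle_at (P + v) P (P + (of_int q *\<^sub>R v + of_int p *\<^sub>R e))"
    using assms unfolding has_lattice_type_def angle_at_def angle.inject by blast
  have pq: "1 \<le> q" "q \<le> p" "coprime p q" using assms unfolding has_lattice_type_def by auto
  have pr: "primitive_vector v" "primitive_vector (of_int q *\<^sub>R v + of_int p *\<^sub>R e)"
    using primitive_vectorI[OF v, of 0 1] primitive_vectorI[OF v pq(3)] by simp_all
  obtain k where k: "0 < k" "v = k *\<^sub>R (A - P)"
    using ray_eqD[of P A v] eq pr(1) by (auto simp: angle_at_def primitive_vector_def)
  obtain l where l: "0 < l" "of_int q *\<^sub>R v + of_int p *\<^sub>R e = l *\<^sub>R (B - P)"
    using ray_eqD[of P B "of_int q *\<^sub>R v + of_int p *\<^sub>R e"] eq pr(2)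
    by (auto simp: angle_at_def primitive_vector_def)
  have "of_int p * det2 v e = det2 v (of_int q *\<^sub>R v + of_int p *\<^sub>R e)" by simp
  also have "\<dots> = k * l * det2 (A - P) (B - P)" unfolding l(2) unfolding k(2) by (simp del: det2_simps(3,4))
  finally have "sgn (of_int p * det2 v e) = sgn (k * l * det2 (A - P) (B - P))" by simp
  then have "sgn (det2 v e) = sgn (det2 (A - P) (B - P))"
    using k l pq by (simp add: sgn_mult del: det2_simps)
  moreover have "sgn (det2 v e) = det2 v e" using v(3) by (auto simp: sgn_if abs_if split: if_splits)
  ultimately have "det2 v e = sgn (det2 (A - P) (B - P))" by simp
  then show thesis using that[OF v _ k(1) l(1) k(2) l(2) pr] by blast
qed

section \<open>Triangles\<close>

text \<open>The integer \<open>g = - d * det2 v1 e2\<close> inverts \<open>q1\<close> modulo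
  \<open>p1\<close>, because \<open>v2\<close> and \<open>e2\<close> are unimodular, so it differs
  from \<open>r1\<close> by a multiple of \<open>p1\<close>. Expanding the determinant in
  \<open>third\<close> gives \<open>p3 = p1 * q2 + p2 * g\<close>, and that multiple becomes
  \<open>n\<close>.\<close>

lemma side_relation:
  assumes Z: "v1 \<in> Z2" "e1 \<in> Z2" "v2 \<in> Z2" "e2 \<in> Z2"
    and d: "det2 v1 e1 = d" "det2 v2 e2 = d" "\<bar>d\<bar> = 1"
    and side: "v2 = - (of_int q1 *\<^sub>R v1 + of_int p1 *\<^sub>R e1)"
    and third: "of_int p3 * d = det2 (of_int q2 *\<^sub>R v2 + of_int p2 *\<^sub>R e2) v1"
    and inv: "q1 * r1 = 1 + p1 * s1"
  shows "\<exists>n. p3 = p1 * q2 + p2 * r1 - n * (p1 * p2)"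
proof -
  have dd: "d * d = 1" using abs_one_mult_self d by simp
  have dZ: "d \<in> \<int>" using d Z det2_Ints by blast
  obtain g h where gh: "- d * det2 v1 e2 = of_int g" "d * det2 e1 e2 = of_int h"
    using dZ Z by (meson Ints_cases Ints_minus Ints_mult det2_Ints)
  have d_eq: "d = - of_int q1 * det2 v1 e2 - of_int p1 * det2 e1 e2"
    unfolding d(2)[symmetric] by (simp add: side algebra_simps)
  have "d * d = of_int q1 * (- d * det2 v1 e2) - of_int p1 * (d * det2 e1 e2)"
    by (subst (2) d_eq) (simp add: algebra_simps)
  then have "real_of_int 1 = of_int (q1 * g - p1 * h)" unfolding dd gh by simp
  then have "q1 * g = 1 + p1 * h" by linarith
  then have "r1 * (q1 * g) = r1 * (1 + p1 * h)" by simp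
  then have "(q1 * r1) * g = r1 + p1 * (r1 * h)" by (simp add: algebra_simps)
  then have g: "g = r1 - (s1 * g - r1 * h) * p1" unfolding inv by (simp add: algebra_simps)
  have v21: "det2 v2 v1 = of_int p1 * d"
    using det2_swap[of v1 e1] d(1) by (simp add: side)
  have "of_int p3 * (d * d) = d * det2 (of_int q2 *\<^sub>R v2 + of_int p2 *\<^sub>R e2) v1"
    using third by (metis mult.assoc mult.commute)
  also have "\<dots> = of_int (p1 * q2) * (d * d) + of_int p2 * (- d * det2 v1 e2)"
    using det2_swap[of v1 e2] by (simp add: v21 algebra_simps)
  finally have "real_of_int p3 = of_int (p1 * q2 + p2 * g)" unfolding dd gh by simp
  then have "p3 = p1 * q2 + p2 * g" by (simp only: of_int_eq_iff)
  also have "\<dots> = p1 * q2 + p2 * r1 - (s1 * g - r1 * h) * (p1 * p2)"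
    by (subst g) (simp add: algebra_simps)
  finally show ?thesis by blast
qed

text \<open>The two primitive vectors along a side, one from each end, are opposite. So the second
  arm at each vertex is the negated first arm at the next, which is the situation of
  \<open>side_relation\<close>.\<close>

lemma triangle_sine_relation:
  assumes types: "has_lattice_type (angle_at C A B) p1 q1" "has_lattice_type (angle_at A B C) p2 q2"
      "has_lattice_type (angle_at B C A) p3 q3"
    and inv: "q1 * r1 = 1 + p1 * s1"
  shows "\<exists>n. p3 = p1 * q2 + p2 * r1 - n * (p1 * p2)"
proof -
  obtain v1 e1 k1 l1 where 1: "v1 \<in> Z2" "e1 \<in> Z2" "\<bar>det2 v1 e1\<bar> = 1"
    "det2 v1 e1 = sgn (det2 (C - A) (B - A))" "0 < k1" "0 < l1" "v1 = k1 *\<^sub>R (C - A)"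
    "of_int q1 *\<^sub>R v1 + of_int p1 *\<^sub>R e1 = l1 *\<^sub>R (B - A)" "primitive_vector v1"
    "primitive_vector (of_int q1 *\<^sub>R v1 + of_int p1 *\<^sub>R e1)"
    by (rule has_lattice_type_angle_atD[OF types(1)])
  obtain v2 e2 k2 l2 where 2: "v2 \<in> Z2" "e2 \<in> Z2" "\<bar>det2 v2 e2\<bar> = 1"
    "det2 v2 e2 = sgn (det2 (A - B) (C - B))" "0 < k2" "0 < l2" "v2 = k2 *\<^sub>R (A - B)"
    "of_int q2 *\<^sub>R v2 + of_int p2 *\<^sub>R e2 = l2 *\<^sub>R (C - B)" "primitive_vector v2"
    "primitive_vector (of_int q2 *\<^sub>R v2 + of_int p2 *\<^sub>R e2)"
    by (rule has_lattice_type_angle_atD[OF types(2)])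
  obtain v3 e3 k3 l3 where 3: "v3 \<in> Z2" "e3 \<in> Z2" "\<bar>det2 v3 e3\<bar> = 1"
    "det2 v3 e3 = sgn (det2 (B - C) (A - C))" "0 < k3" "0 < l3" "v3 = k3 *\<^sub>R (B - C)"
    "of_int q3 *\<^sub>R v3 + of_int p3 *\<^sub>R e3 = l3 *\<^sub>R (A - C)" "primitive_vector v3"
    "primitive_vector (of_int q3 *\<^sub>R v3 + of_int p3 *\<^sub>R e3)"
    by (rule has_lattice_type_angle_atD[OF types(3)])
  \<comment> \<open>The doubled signed area is invariant under cyclic shifts, so all three bases
    have the same determinant.\<close>
  have orient: "det2 (A - B) (C - B) = det2 (C - A) (B - A)"
    "det2 (B - C) (A - C) = det2 (C - A) (B - A)"
    by (simp_all add: det2_def algebra_simps)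
  have opp: "v = - w"
    if pr: "primitive_vector v" "primitive_vector w" and "v = k *\<^sub>R (X - Y)" "w = l *\<^sub>R (Y - X)"
      "0 < k" "0 < l" for v w X Y and k l :: real
  proof -
    have "primitive_vector (- w)"
      using pr(2) unfolding primitive_vector_def
    proof (intro conjI; (elim conjE)?)
      assume w: "w \<in> Z2" "w \<noteq> 0" "open_segment 0 w \<inter> Z2 = {}"
      have "t *\<^sub>R w \<notin> Z2" if "0 < t" "t < 1" for t
        using w that by (auto simp: in_segment disjoint_iff)
      then have "- (t *\<^sub>R w) \<notin> Z2" if "0 < t" "t < 1" for t
        using that Z2_closed(4)[of "- (t *\<^sub>R w)"] by auto
      then show "open_segment 0 (- w) \<inter> Z2 = {}" by (auto simp: in_segment)
    qed auto
    moreover have "- w = l *\<^sub>R (X - Y)" unfolding that(4) by (simp add: algebra_simps)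
    then have "v = (k / l) *\<^sub>R (- w)" using that(3,6) by simp
    ultimately show ?thesis
      by (metis primitive_vector_unique pr(1) divide_nonneg_pos less_imp_le that(5,6))
  qed
  define d where "d = det2 v1 e1"
  have d: "\<bar>d\<bar> = 1" "det2 v2 e2 = d" "det2 v3 e3 = d"
    using 1(3,4) 2(4) 3(4) orient by (simp_all only: d_def)
  have v2: "v2 = - (of_int q1 *\<^sub>R v1 + of_int p1 *\<^sub>R e1)"
    by (rule opp[OF 2(9) 1(10) 2(7) 1(8) 2(5) 1(6)])
  have v3: "v3 = - (of_int q2 *\<^sub>R v2 + of_int p2 *\<^sub>R e2)"
    by (rule opp[OF 3(9) 2(10) 3(7) 2(8) 3(5) 2(6)])
  have v1: "v1 = - (of_int q3 *\<^sub>R v3 + of_int p3 *\<^sub>R e3)"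
    by (rule opp[OF 1(9) 3(10) 1(7) 3(8) 1(5) 3(6)])
  \<comment> \<open>In the expansion of \<open>v1\<close> at the third vertex only the
    \<open>e3\<close> component contributes to the determinant with \<open>v3\<close>.\<close>
  have "of_int p3 * d = det2 (- v3) v1"
    by (subst v1) (simp add: d)
  then have third: "of_int p3 * d = det2 (of_int q2 *\<^sub>R v2 + of_int p2 *\<^sub>R e2) v1"
    unfolding v3 by simp
  show ?thesis
    by (rule side_relation[OF 1(1,2) 2(1,2) d_def[symmetric] d(2,1) v2 third inv])
qed

text \<open>By the lattice law of sines, each side is taken as the sine of the opposite angle times
  a primitive direction. The first equation in \<open>c\<close> closes the triangle, the second
  gives the angle at \<open>C\<close> the correct cosine.\<close>

lemma triangle_exists:
  assumes m: "odd_cf_matrix p1 q1 r1 s1" "odd_cf_matrix p2 q2 r2 s2" "odd_cf_matrix p3 q3 r3 s3"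
    and c: "p3 = p1 * q2 + p2 * r1 - p1 * p2" "p1 = p2 * q3 + p3 * r2 - p2 * p3"
  shows "\<exists>A B C. lattice_triangle A B C \<and> has_lattice_type (angle_at C A B) p1 q1 \<and>
    has_lattice_type (angle_at A B C) p2 q2 \<and> has_lattice_type (angle_at B C A) p3 q3"
proof -
  have pos: "1 \<le> q1" "q1 \<le> p1" "1 \<le> q2" "q2 \<le> p2" "1 \<le> q3" "q3 \<le> p3"
    and inv: "q1 * r1 = 1 + p1 * s1" "q2 * r2 = 1 + p2 * s2" "q3 * r3 = 1 + p3 * s3"
    using m by (auto simp: odd_cf_matrix_def)
  have cop: "coprime p1 q1" "coprime p2 q2" "coprime p3 q3"
    using coprime_of_det[of p1 s1 q1 r1] coprime_of_det[of p2 s2 q2 r2]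
      coprime_of_det[of p3 s3 q3 r3] inv by simp_all
  have p: "0 < real_of_int p1" "0 < real_of_int p2" "0 < real_of_int p3" using pos by simp_all
  define vec :: "int \<Rightarrow> int \<Rightarrow> real^2" where "vec x y = vector [of_int x, of_int y]" for x y
  have vec_Z2: "vec x y \<in> Z2" for x y by (simp add: vec_def Z2_iff)
  have vec_det: "det2 (vec x y) (vec z t) = of_int (x * t - y * z)" for x y z t
    by (simp add: vec_def det2_def)
  have vec_arith: "vec x y + vec z t = vec (x + z) (y + t)" "vec x y - vec z t = vec (x - z) (y - t)"
    "of_int n *\<^sub>R vec x y = vec (n * x) (n * y)" "- vec x y = vec (- x) (- y)" for x y z t n
    by (simp_all add: vec_def vec_eq_iff forall_2)
  \<comment> \<open>The primitive directions of \<open>AB\<close>, \<open>BC\<close> and \<open>CA\<close> are \<open>(1, 0)\<close>, \<open>(-q2, -p2)\<close> and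
    \<open>(p1 - r1, p1)\<close>; their pairwise determinants are \<open>p1\<close>, \<open>p2\<close>, \<open>p3\<close>.\<close>
  define A B C where "A = vec 0 0" and "B = vec p3 0" and "C = vec (p2 * (r1 - p1)) (- p2 * p1)"
  \<comment> \<open>Together with \<open>s2\<close>, this divides \<open>(p1 - r1, p1)\<close> minus
    \<open>q3\<close> times \<open>(q2, p2)\<close> by \<open>p3\<close>; the quotient
    \<open>(s2 - q2, r2 - p2)\<close> is the second basis vector at \<open>C\<close>.\<close>
  have r2: "p1 - q3 * p2 = p3 * (r2 - p2)" using c(2) by (simp add: algebra_simps)
  have s2: "p1 - r1 - q3 * q2 = p3 * (s2 - q2)"
  proof -
    have "p2 * (p1 - r1 - q3 * q2) = q2 * (p1 - q3 * p2) - p3"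
      using c(1) by (simp add: algebra_simps)
    also have "\<dots> = p3 * (q2 * r2 - 1) - p2 * p3 * q2" unfolding r2 by (simp add: algebra_simps)
    also have "\<dots> = p2 * (p3 * (s2 - q2))" unfolding inv(2) by (simp add: algebra_simps)
    finally show ?thesis using pos by simp
  qed
  have CB: "C - B = of_int p1 *\<^sub>R vec (- q2) (- p2)"
    using c(1) by (simp add: C_def B_def vec_arith algebra_simps)
  have "has_lattice_type (angle_at C A B) p1 q1"
  \<comment> \<open>The vector \<open>e\<close> solves \<open>q1 * v + p1 * e = (1, 0)\<close>, the
    direction of \<open>AB\<close>; it is integral because
    \<open>q1 * r1 - p1 * s1 = 1\<close>.\<close>
  proof (rule has_lattice_type_angle_atI[where v = "vec (r1 - p1) (- p1)" and e = "vec (q1 - s1) q1"])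
    show "C - A = of_int p2 *\<^sub>R vec (r1 - p1) (- p1)" by (simp add: A_def C_def vec_arith)
    show "\<bar>det2 (vec (r1 - p1) (- p1)) (vec (q1 - s1) q1)\<bar> = 1"
      using inv(1) by (simp only: vec_det) (simp add: algebra_simps)
    have "of_int q1 *\<^sub>R vec (r1 - p1) (- p1) + of_int p1 *\<^sub>R vec (q1 - s1) q1 = vec 1 0"
      using inv(1) by (simp add: vec_arith algebra_simps)
    then show "B - A = of_int p3 *\<^sub>R
        (of_int q1 *\<^sub>R vec (r1 - p1) (- p1) + of_int p1 *\<^sub>R vec (q1 - s1) q1)"
      by (simp add: A_def B_def vec_arith)
  qed (use pos cop p in \<open>simp_all add: A_def vec_Z2\<close>)
  moreover have "has_lattice_type (angle_at A B C) p2 q2"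
  proof (rule has_lattice_type_angle_atI[where v = "vec (- 1) 0" and e = "vec 0 (- 1)"])
    show "A - B = of_int p3 *\<^sub>R vec (- 1) 0" by (simp add: A_def B_def vec_arith)
    show "\<bar>det2 (vec (- 1) 0) (vec 0 (- 1))\<bar> = 1" by (simp add: vec_det)
    show "C - B = of_int p1 *\<^sub>R (of_int q2 *\<^sub>R vec (- 1) 0 + of_int p2 *\<^sub>R vec 0 (- 1))"
      unfolding CB by (simp add: vec_arith)
  qed (use pos cop p in \<open>simp_all add: B_def vec_Z2\<close>)
  moreover have "has_lattice_type (angle_at B C A) p3 q3"
  proof (rule has_lattice_type_angle_atI[where v = "vec q2 p2" and e = "vec (s2 - q2) (r2 - p2)"])
    have "B - C = - (C - B)" by simp
    then show "B - C = of_int p1 *\<^sub>R vec q2 p2" unfolding CB by (simp add: vec_arith)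
    show "\<bar>det2 (vec q2 p2) (vec (s2 - q2) (r2 - p2))\<bar> = 1"
      using inv(2) by (simp only: vec_det) (simp add: algebra_simps)
    have "of_int q3 *\<^sub>R vec q2 p2 + of_int p3 *\<^sub>R vec (s2 - q2) (r2 - p2) = vec (p1 - r1) p1"
      unfolding vec_arith r2[symmetric] s2[symmetric] by simp
    then show "A - C = of_int p2 *\<^sub>R
        (of_int q3 *\<^sub>R vec q2 p2 + of_int p3 *\<^sub>R vec (s2 - q2) (r2 - p2))"
      by (simp add: A_def C_def vec_arith algebra_simps)
  qed (use pos cop p in \<open>simp_all add: C_def vec_Z2\<close>)
  moreover have "lattice_triangle A B C"
  proof -
    have "A - B = vec (- p3) 0" "C - B = vec (- p1 * q2) (- p1 * p2)"
      unfolding CB by (simp_all add: A_def B_def vec_arith)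
    then have "det2 (A - B) (C - B) = of_int p3 * (of_int p1 * of_int p2)"
      by (simp only: vec_det) simp
    then have "det2 (A - B) (C - B) \<noteq> 0" using p by simp
    then show ?thesis by (simp only: lattice_triangle_def collinear_iff_det2 A_def B_def C_def vec_Z2 simp_thms)
  qed
  ultimately show ?thesis by blast
qed

section \<open>Realising three given angles by a triangle\<close>

lemma angle_at_lattice_triangle:
  assumes "lattice_triangle A B C"
  shows "ordinary_lattice_angle (angle_at C A B)"
proof -
  have "{C, A, B} = {A, B, C}" by auto
  then show ?thesis using assms unfolding ordinary_lattice_angle_def lattice_triangle_def by metis
qed

lemma lattice_triangle_rotate: "lattice_triangle A B C \<Longrightarrow> lattice_triangle B C A"
  by (simp add: lattice_triangle_def insert_commute)

theorem theorem2p2: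
  fixes \<alpha> :: "3 \<Rightarrow> angle"
  assumes "\<And>i. ordinary_lattice_angle (\<alpha> i)"
  shows "(\<exists>A B C. lattice_triangle A B C \<and>
            lattice_congruent (angle_at C A B) (\<alpha> 1) \<and>
            lattice_congruent (angle_at A B C) (\<alpha> 2) \<and>
            lattice_congruent (angle_at B C A) (\<alpha> 3)) \<longleftrightarrow>
         (\<exists>i. (cf_rats [ltan (\<alpha> i), -1, ltan (\<alpha> (i + 1))] < 0 \<or>
               cf_rats [ltan (\<alpha> i), -1, ltan (\<alpha> (i + 1))] > ereal (of_rat (ltan (\<alpha> i)))) \<and>
              cf_rats [ltan (\<alpha> i), -1, ltan (\<alpha> (i + 1)), -1, ltan (\<alpha> (i + 2))] = 0)"
    (is "?L \<longleftrightarrow> ?R")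
proof -
  have "\<exists>p q r s. has_lattice_type (\<alpha> i) p q \<and> odd_cf_matrix p q r s" for i
  proof -
    obtain p q where t: "has_lattice_type (\<alpha> i) p q"
      using ordinary_lattice_angle_type[OF assms] by blast
    then obtain r s where "odd_cf_matrix p q r s"
      using odd_cf_matrix_exists[of q p] unfolding has_lattice_type_def by blast
    then show ?thesis using t by blast
  qed
  then obtain p q r s where t: "\<And>i. has_lattice_type (\<alpha> i) (p i) (q i)"
    and m: "\<And>i. odd_cf_matrix (p i) (q i) (r i) (s i)" by metis
  \<comment> \<open>Addition in the type \<open>3\<close> is modulo 3, so the indices wrap around
    cyclically.\<close>
  have idx: "(1::3) + 1 = 2" "(2::3) + 1 = 3" "(3::3) + 1 = 1"
    "(1::3) + 2 = 3" "(2::3) + 2 = 1" "(3::3) + 2 = 2" by simp_all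
  \<comment> \<open>The relation \<open>n = 1\<close> at the side between angles \<open>i\<close>
    and \<open>j\<close> and at the side between \<open>j\<close> and \<open>k\<close>.\<close>
  define E where "E i j k \<longleftrightarrow> p k = p i * q j + p j * r i - p i * p j \<and>
    p i = p j * q k + p k * r j - p j * p k" for i j k
  have ex3: "(\<exists>i::3. P i) \<longleftrightarrow> P 1 \<or> P 2 \<or> P 3" for P by (metis exhaust_3)
  have R: "?R \<longleftrightarrow> E 1 2 3 \<or> E 2 3 1 \<or> E 3 1 2"
    unfolding ltan_eq_type[OF t] cf_rats_condition_iff[OF m m m] E_def[symmetric] by (simp only: ex3 idx)
  have pos: "1 \<le> q i" "q i \<le> p i" "1 \<le> r i" "r i \<le> p i" "q i * r i = 1 + p i * s i" for i
    using m[of i] by (auto simp: odd_cf_matrix_def)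
  have L: "?L \<longleftrightarrow> (\<exists>A B C. lattice_triangle A B C \<and> has_lattice_type (angle_at C A B) (p 1) (q 1) \<and>
      has_lattice_type (angle_at A B C) (p 2) (q 2) \<and> has_lattice_type (angle_at B C A) (p 3) (q 3))"
  proof -
    have "lattice_congruent \<beta> (\<alpha> i) \<longleftrightarrow> has_lattice_type \<beta> (p i) (q i)"
      if \<beta>: "ordinary_lattice_angle \<beta>" for \<beta> i
    proof
      assume c: "lattice_congruent \<beta> (\<alpha> i)"
      obtain p' q' where b: "has_lattice_type \<beta> p' q'"
        using ordinary_lattice_angle_type[OF \<beta>] by blast
      note a = has_lattice_type_congruent[OF b c]
      \<comment> \<open>\<open>\<alpha> i\<close> has both types, while its lattice tangent is a
        single number; reduced fractions with positive denominators then coincide.\<close>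
      have "(of_int p' :: rat) / of_int q' = of_int (p i) / of_int (q i)"
        using ltan_eq_type[OF a] ltan_eq_type[OF t[of i]] by simp
      moreover have q': "0 < q'" "coprime p' q'" "coprime (p i) (q i)"
        using b t[of i] unfolding has_lattice_type_def by auto
      ultimately have "(of_int (p' * q i) :: rat) = of_int (p i * q')"
        using pos(1)[of i] by (simp add: field_simps)
      then have "p' * q i = p i * q'" by (simp only: of_int_eq_iff)
      then show "has_lattice_type \<beta> (p i) (q i)"
        using coprime_fraction_unique[of p' q' "p i" "q i"] q' pos(1)[of i] b by auto
    next
      assume "has_lattice_type \<beta> (p i) (q i)"
      then show "lattice_congruent \<beta> (\<alpha> i)" using lattice_congruent_same_type t by blast
    qed
    then show ?thesis using angle_at_lattice_triangle lattice_triangle_rotate by meson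
  qed
  show ?thesis unfolding L R
  proof
    assume "\<exists>A B C. lattice_triangle A B C \<and> has_lattice_type (angle_at C A B) (p 1) (q 1) \<and>
      has_lattice_type (angle_at A B C) (p 2) (q 2) \<and> has_lattice_type (angle_at B C A) (p 3) (q 3)"
    then obtain A B C where ty: "has_lattice_type (angle_at C A B) (p 1) (q 1)"
        "has_lattice_type (angle_at A B C) (p 2) (q 2)"
        "has_lattice_type (angle_at B C A) (p 3) (q 3)" by blast
    obtain n3 n1 n2 where n: "p 3 = p 1 * q 2 + p 2 * r 1 - n3 * (p 1 * p 2)"
      "p 1 = p 2 * q 3 + p 3 * r 2 - n1 * (p 2 * p 3)"
      "p 2 = p 3 * q 1 + p 1 * r 3 - n2 * (p 3 * p 1)"
      using triangle_sine_relation[OF ty pos(5)] triangle_sine_relation[OF ty(2,3,1) pos(5)]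
        triangle_sine_relation[OF ty(3,1,2) pos(5)]
      by blast
    have "n3 = 1 \<and> n1 = 1 \<or> n1 = 1 \<and> n2 = 1 \<or> n2 = 1 \<and> n3 = 1"
      by (rule two_sides_minimal[OF pos(1,2) pos(1,2) pos(1,2) pos(3,4) pos(3,4) pos(3,4) n])
    moreover have "E 1 2 3" if "n3 = 1" "n1 = 1" using n(1,2) unfolding that mult_1 E_def by (rule conjI)
    moreover have "E 2 3 1" if "n1 = 1" "n2 = 1" using n(2,3) unfolding that mult_1 E_def by (rule conjI)
    moreover have "E 3 1 2" if "n2 = 1" "n3 = 1" using n(3,1) unfolding that mult_1 E_def by (rule conjI)
    ultimately show "E 1 2 3 \<or> E 2 3 1 \<or> E 3 1 2" by blast
  next
    \<comment> \<open>The construction starts at angle \<open>i\<close>; for \<open>i\<close> other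
      than 1 the vertices are renamed cyclically afterwards.\<close>
    have ex: "\<exists>A B C. lattice_triangle A B C \<and> has_lattice_type (angle_at C A B) (p i) (q i) \<and>
      has_lattice_type (angle_at A B C) (p j) (q j) \<and> has_lattice_type (angle_at B C A) (p k) (q k)"
      if "E i j k" for i j k
      using triangle_exists[OF m m m] that unfolding E_def by blast
    assume "E 1 2 3 \<or> E 2 3 1 \<or> E 3 1 2"
    then show "\<exists>A B C. lattice_triangle A B C \<and> has_lattice_type (angle_at C A B) (p 1) (q 1) \<and>
      has_lattice_type (angle_at A B C) (p 2) (q 2) \<and> has_lattice_type (angle_at B C A) (p 3) (q 3)"
      using ex lattice_triangle_rotate by meson
  qed
qed

end
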